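(* Let $(X,d,\mu)$ be a non-homogeneous metric measure space (geometrically doubling and upper doubling) with dominating function $\lambda$ and geometric dimension $n=\log_2 N_0$. Let $0<\alpha<n$, $1<p<n/\alpha$ and $1/q=1/p-\alpha/n$. Let $K_\alpha$ be a fractional kernel of order $\alpha$ and regularity $\epsilon$ for some $0<\epsilon\le 1$, and let $I_\alpha$ be the fractional integral operator $$I_\alpha f(x)=\int_X K_\alpha(x,y)f(y)\,d\mu(y).$$ Then there exists a constant $C>0$ such that for all $f\in L^p(\mu)$, $$\|I_\alpha f\|_{L^q(\mu)}\le C\|f\|_{L^p(\mu)}.$$
   Context: **Balls.** For a metric space $(X,d)$, $B(x,r)=\{y\in X: d(x,y)<r\}$. **Geometrically doubling.** A metric space $(X,d)$ is geometrically doubling if there is $N_0\in\mathbb N$ such that every ball $B(x,r)\subset X$ has a finite covering by balls $B(x_i,r/2)$ of cardinality at most $N_0$. Fix such an $N_0$ and set $n=\log_2 N_0$ (the geometric dimension). **Upper doubling.** $(X,d,\mu)$ is upper doubling if $\mu$ is a Borel measure on $X$ and there are a dominating function $\lambda:X\times(0,+\infty)\to(0,+\infty)$ and a constant $C_\lambda>0$ such that for each $x\in X$ the map $r\mapsto\lambda(x,r)$ is non-decreasing, and for all $x\in X$, $r>0$, $$\mu(B(x,r))\le\lambda(x,r)\le C_\lambda\lambda(x,r/2).$$ Standing assumption: there is a constant $\widetilde C$ such that $\lambda(x,r)\le\widetilde C\lambda(y,r)$ for all $x,y\in X$ with $d(x,y)\le r$. **Non-homogeneous metric measure space.** A metric measure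 space that is both geometrically doubling and upper doubling. **Fractional kernel of order $\alpha$ and regularity $\epsilon$** ($0<\alpha<n$, $0<\epsilon\le1$). A function $K_\alpha\in L^1_{loc}(X\times X\setminus\{(x,y):x=y\})$ for which there are positive constants $C,C'$ such that (i) for all $x\ne y$, $\displaystyle |K_\alpha(x,y)|\le\frac{C}{[\lambda(x,d(x,y))]^{1-\alpha/n}}$; (ii) whenever $x\neq y$, $x'\neq y$ and $C'd(x,x')\le d(x,y)$, $$|K_\alpha(x,y)-K_\alpha(x',y)|+|K_\alpha(y,x)-K_\alpha(y,x')|\le\frac{C\,d(x,x')^\epsilon}{d(x,y)^\epsilon[\lambda(x,d(x,y))]^{1-\alpha/n}}.$$ Since $K_\alpha$ is defined only off the diagonal, the integral defining $I_\alpha f(x)$ is over $y\ne x$. *)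

theory Defs
  imports "HOL-Analysis.Analysis"
begin

definition geometrically_doubling :: "'a::metric_space set \<Rightarrow> nat \<Rightarrow> bool" where
  "geometrically_doubling X N0 \<longleftrightarrow>
     (\<forall>x\<in>X. \<forall>r>0. \<exists>T. T \<subseteq> X \<and> finite T \<and> card T \<le> N0 \<and>
        X \<inter> ball x r \<subseteq> (\<Union>y\<in>T. ball y (r / 2)))"

text \<open>The dominating function is only ever evaluated at positive radii; its values at
  nonpositive radii are irrelevant.\<close>

definition upper_doubling :: "'a::metric_space measure \<Rightarrow> ('a \<Rightarrow> real \<Rightarrow> real) \<Rightarrow> bool" where
  "upper_doubling M lam \<longleftrightarrow>
     sets M = sets borel \<and>
     (\<forall>x. \<forall>r>0. lam x r > 0) \<and>
     (\<forall>x. mono_on {0<..} (lam x)) \<and>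
     (\<exists>C>0. \<forall>x. \<forall>r>0. emeasure M (ball x r) \<le> ennreal (lam x r) \<and>
                      lam x r \<le> C * lam x (r / 2))"

definition comparable_at_scale :: "('a::metric_space \<Rightarrow> real \<Rightarrow> real) \<Rightarrow> bool" where
  "comparable_at_scale lam \<longleftrightarrow>
     (\<exists>C. \<forall>x y. \<forall>r>0. dist x y \<le> r \<longrightarrow> lam x r \<le> C * lam y r)"

text \<open>The standing comparability assumption on the dominating function is included.\<close>

definition nonhomogeneous_space ::
  "'a::metric_space measure \<Rightarrow> ('a \<Rightarrow> real \<Rightarrow> real) \<Rightarrow> nat \<Rightarrow> bool" where
  "nonhomogeneous_space M lam N0 \<longleftrightarrow>
     geometrically_doubling (UNIV :: 'a set) N0 \<and> upper_doubling M lam \<and> comparable_at_scale lam"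

text \<open>Kernels take values in an arbitrary complete separable normed field over the reals, so
  that the real and the complex case are both covered. Local integrability means integrability
  on each compact subset of the complement of the diagonal; the values of \<open>K\<close> on the diagonal
  are unconstrained.\<close>

definition locally_integrable_off_diagonal ::
  "'a::metric_space measure
     \<Rightarrow> ('a \<Rightarrow> 'a \<Rightarrow> 'k::{real_normed_field, banach, second_countable_topology}) \<Rightarrow> bool" where
  "locally_integrable_off_diagonal M K \<longleftrightarrow>
     (\<forall>S. compact S \<and> S \<subseteq> {(x, y). x \<noteq> y} \<longrightarrow>
        set_integrable (M \<Otimes>\<^sub>M M) S (\<lambda>(x, y). K x y))"

definition fractional_kernel ::
  "'a::metric_space measure \<Rightarrow> ('a \<Rightarrow> real \<Rightarrow> real) \<Rightarrow> real \<Rightarrow> real \<Rightarrow> real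
     \<Rightarrow> ('a \<Rightarrow> 'a \<Rightarrow> 'k::{real_normed_field, banach, second_countable_topology}) \<Rightarrow> bool" where
  "fractional_kernel M lam n \<alpha> \<epsilon> K \<longleftrightarrow>
     locally_integrable_off_diagonal M K \<and>
     (\<exists>C>0. \<exists>C'>0.
        (\<forall>x y. x \<noteq> y \<longrightarrow> norm (K x y) \<le> C / (lam x (dist x y)) powr (1 - \<alpha> / n)) \<and>
        (\<forall>x x' y. x \<noteq> y \<and> x' \<noteq> y \<and> C' * dist x x' \<le> dist x y \<longrightarrow>
           norm (K x y - K x' y) + norm (K y x - K y x')
             \<le> C * dist x x' powr \<epsilon>
                 / (dist x y powr \<epsilon> * (lam x (dist x y)) powr (1 - \<alpha> / n))))"

text \<open>The integral runs over \<open>y \<noteq> x\<close>, which matters when \<open>M\<close> has atoms.\<close>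

definition fractional_integral ::
  "'a::metric_space measure
     \<Rightarrow> ('a \<Rightarrow> 'a \<Rightarrow> 'k::{real_normed_field, banach, second_countable_topology})
     \<Rightarrow> ('a \<Rightarrow> 'k) \<Rightarrow> 'a \<Rightarrow> 'k" where
  "fractional_integral M K f x = (LINT y:(- {x})|M. K x y * f y)"

text \<open>Functions are not identified up to null sets. The norm below is meaningful only for
  functions in \<open>Lp_space\<close>, since the Bochner integral of a non-integrable function is 0.\<close>

definition Lp_space ::
  "real \<Rightarrow> 'a measure \<Rightarrow> ('a \<Rightarrow> 'k::{real_normed_field, banach, second_countable_topology}) set" where
  "Lp_space p M = {f \<in> borel_measurable M. integrable M (\<lambda>x. norm (f x) powr p)}"

definition Lp_norm ::
  "real \<Rightarrow> 'a measure \<Rightarrow> ('a \<Rightarrow> 'k::{real_normed_field, banach, second_countable_topology}) \<Rightarrow> real" where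
  "Lp_norm p M f = (LINT x|M. norm (f x) powr p) powr (1 / p)"

end

theory Submission imports Defs begin

text \<open>Write \<open>\<theta> = \<alpha> / n\<close> and let \<open>m\<close> be the supremum over the balls \<open>B(z,r)\<close> containing \<open>x\<close> of
  the integral of \<open>\<bar>f\<bar>\<close> over \<open>B(z,r)\<close> divided by \<open>\<lambda>(z,r)\<close>. Since the measure of \<open>B(z,3r)\<close> is
  controlled by \<open>\<lambda>(z,r)\<close>, the Vitali covering argument gives the weak type (1,1) bound for \<open>m\<close>, and
  summing over dyadic levels of the truncated function gives the strong type (p,p) bound.

  The off-diagonal space is cut not into dyadic annuli, as \<open>\<lambda>(x,\<cdot>)\<close> may fail to grow
  geometrically, but into the dyadic level sets \<open>{y. 2^k < \<lambda>(x,d(x,y)) \<le> 2^(k+1)}\<close>. The \<open>k\<close>-th one has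
  measure at most a constant times \<open>2^k\<close>, so it contributes at most a constant times the minimum of
  \<open>2^(k\<theta>) m\<close> and \<open>2^(-k(1/p-\<theta>)) \<parallel>f\<parallel>\<^sub>p\<close>. Summing over \<open>k\<close> yields the Hedberg inequality
  \<open>\<bar>I f\<bar> \<le> C \<parallel>f\<parallel>\<^sub>p^(1-p/q) m^(p/q)\<close>, and the bound for \<open>m\<close> finishes the estimate.
  The regularity of the kernel is needed only for its continuity off the diagonal, hence for
  measurability.\<close>

subsection \<open>Separability and coverings\<close>

text \<open>Iterating the halving \<open>k\<close> times reaches arbitrarily small radii; finiteness
  of the cover is what separability asks for.\<close>

lemma geometrically_doubling_cover:
  assumes "geometrically_doubling (UNIV :: 'a::metric_space set) N0" and "r > 0"
  shows "\<exists>T::'a set. finite T \<and> ball x r \<subseteq> (\<Union>y\<in>T. ball y (r / 2 ^ k))"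
proof (induction k)
  case 0
  show ?case by (intro exI[of _ "{x}"]) auto
next
  case (Suc k)
  then obtain T :: "'a set" where T: "finite T" "ball x r \<subseteq> (\<Union>y\<in>T. ball y (r / 2 ^ k))" by blast
  have "\<forall>y. \<exists>S::'a set. finite S \<and> ball y (r / 2 ^ k) \<subseteq> (\<Union>z\<in>S. ball z (r / 2 ^ Suc k))"
  proof
    fix y :: 'a
    have "r / 2 ^ k > 0" using assms(2) by simp
    then obtain S :: "'a set" where "finite S" "ball y (r / 2 ^ k) \<subseteq> (\<Union>z\<in>S. ball z (r / 2 ^ k / 2))"
      using assms(1) unfolding geometrically_doubling_def by (metis Int_UNIV_left UNIV_I)
    then show "\<exists>S::'a set. finite S \<and> ball y (r / 2 ^ k) \<subseteq> (\<Union>z\<in>S. ball z (r / 2 ^ Suc k))"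
      by (auto simp: field_simps)
  qed
  then obtain S :: "'a \<Rightarrow> 'a set" where S: "\<And>y. finite (S y)"
    "\<And>y. ball y (r / 2 ^ k) \<subseteq> (\<Union>z\<in>S y. ball z (r / 2 ^ Suc k))" by metis
  have "ball x r \<subseteq> (\<Union>y\<in>T. \<Union>z\<in>S y. ball z (r / 2 ^ Suc k))"
    using T(2) S(2) by (blast dest: subsetD)
  then show ?case
    using T(1) S(1) by (intro exI[of _ "\<Union>y\<in>T. S y"]) simp
qed

text \<open>The dense set consists of the centres of finite covers of the balls of radius
  \<open>m + 1\<close> about one point by balls of radius \<open>(m + 1) / 2 ^ k\<close>, over all
  \<open>m\<close> and \<open>k\<close>.\<close>

lemma geometrically_doubling_countable_dense:
  assumes "geometrically_doubling (UNIV :: 'a::metric_space set) N0"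
  shows "\<exists>D::'a set. countable D \<and> (\<forall>x. \<forall>e>0. \<exists>d\<in>D. dist d x < e)"
proof -
  define x0 :: 'a where "x0 = undefined"
  have "\<forall>m k. \<exists>T::'a set. finite T \<and> ball x0 (real (Suc m)) \<subseteq> (\<Union>y\<in>T. ball y (real (Suc m) / 2 ^ k))"
    using geometrically_doubling_cover[OF assms] by (metis of_nat_0_less_iff zero_less_Suc)
  then obtain T :: "nat \<Rightarrow> nat \<Rightarrow> 'a set" where T: "\<And>m k. finite (T m k)"
    "\<And>m k. ball x0 (real (Suc m)) \<subseteq> (\<Union>y\<in>T m k. ball y (real (Suc m) / 2 ^ k))" by metis
  show ?thesis
  proof (intro exI[of _ "\<Union>m k. T m k"] conjI allI impI)
    show "countable (\<Union>m k. T m k)" using T(1) by (intro countable_UN countableI_type countable_finite)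
    fix x :: 'a and e :: real assume "e > 0"
    obtain m where m: "dist x0 x < real (Suc m)"
      using reals_Archimedean2 by (metis lessI less_trans of_nat_less_iff)
    obtain k where "real (Suc m) / e < 2 ^ k" using real_arch_pow[of 2] by fastforce
    then have k: "real (Suc m) / 2 ^ k < e" using \<open>e > 0\<close> by (simp add: field_simps)
    from m T(2)[of m k] obtain y where "y \<in> T m k" "dist y x < real (Suc m) / 2 ^ k" by auto
    with k show "\<exists>d\<in>\<Union>m k. T m k. dist d x < e" by (intro bexI[of _ y]) auto
  qed
qed

lemma countable_dense_ball_base:
  fixes D :: "'a::metric_space set"
  assumes "\<forall>x. \<forall>e>0. \<exists>d\<in>D. dist d x < e" and "open U" and "x \<in> U"
  shows "\<exists>d\<in>D. \<exists>m::nat. x \<in> ball d (1 / real (Suc m)) \<and> ball d (1 / real (Suc m)) \<subseteq> U"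
proof -
  obtain e where e: "e > 0" "ball x e \<subseteq> U" using assms openE by blast
  obtain m where m: "1 / real (Suc m) < e / 2" using nat_approx_posE[of "e/2"] e by auto
  obtain d where d: "d \<in> D" "dist d x < 1 / real (Suc m)" using assms(1)
    by (metis of_nat_0_less_iff zero_less_Suc zero_less_divide_1_iff)
  have "ball d (1 / real (Suc m)) \<subseteq> ball x e"
  proof
    fix y assume "y \<in> ball d (1 / real (Suc m))"
    then have "dist x y < 1 / real (Suc m) + 1 / real (Suc m)"
      using d(2) dist_triangle[of x y d] by (simp add: dist_commute)
    then show "y \<in> ball x e" using m by simp
  qed
  then show ?thesis using d e(2) by (intro bexI[of _ d] exI[of _ m]) auto
qed

text \<open>The basic balls contained in some \<open>U i\<close> are countably many, and choosing
  one index for each keeps the union. This later replaces the uncountable family of balls in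
  \<open>maximal_level\<close> by a countable one.\<close>

lemma countable_dense_Lindelof:
  fixes D :: "'a::metric_space set"
  assumes "countable D" and D: "\<forall>x. \<forall>e>0. \<exists>d\<in>D. dist d x < e"
    and op: "\<And>i. i \<in> I \<Longrightarrow> open (U i :: 'a set)"
  shows "\<exists>J\<subseteq>I. countable J \<and> (\<Union>i\<in>I. U i) = (\<Union>i\<in>J. U i)"
proof -
  define P where "P = {(d, m::nat). d \<in> D \<and> (\<exists>i\<in>I. ball d (1 / real (Suc m)) \<subseteq> U i)}"
  have "countable P"
    by (rule countable_subset[of _ "D \<times> UNIV"]) (auto simp: P_def assms(1))
  have "\<forall>u\<in>P. \<exists>i\<in>I. ball (fst u) (1 / real (Suc (snd u))) \<subseteq> U i" by (auto simp: P_def)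
  then obtain h where h: "\<And>u. u \<in> P \<Longrightarrow> h u \<in> I" 
    "\<And>u. u \<in> P \<Longrightarrow> ball (fst u) (1 / real (Suc (snd u))) \<subseteq> U (h u)" by metis
  show ?thesis
  proof (intro exI[of _ "h ` P"] conjI)
    show "h ` P \<subseteq> I" using h by auto
    show "countable (h ` P)" using \<open>countable P\<close> by simp
    have "(\<Union>i\<in>I. U i) \<subseteq> (\<Union>i\<in>h ` P. U i)"
    proof
      fix x assume "x \<in> (\<Union>i\<in>I. U i)"
      then obtain i where i: "i \<in> I" "x \<in> U i" by auto
      with countable_dense_ball_base[OF D op] obtain d m where
        "d \<in> D" "x \<in> ball d (1 / real (Suc m))" "ball d (1 / real (Suc m)) \<subseteq> U i" by blast
      then have "(d, m) \<in> P" "x \<in> ball d (1 / real (Suc m))" using i by (auto simp: P_def)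
      then have "(d, m) \<in> P" "x \<in> U (h (d, m))" using h(2)[of "(d, m)"] by auto
      then show "x \<in> (\<Union>i\<in>h ` P. U i)" by auto
    qed
    with \<open>h ` P \<subseteq> I\<close> show "(\<Union>i\<in>I. U i) = (\<Union>i\<in>h ` P. U i)" by blast
  qed
qed

text \<open>\<open>borel_prod\<close> does not apply: here second countability comes from the doubling hypothesis,
  not from the type class.\<close>

lemma countable_dense_sets_borel_prod:
  fixes D :: "'a::metric_space set"
  assumes "countable D" and D: "\<forall>x. \<forall>e>0. \<exists>d\<in>D. dist d x < e"
  shows "sets borel \<subseteq> sets (borel \<Otimes>\<^sub>M borel :: ('a \<times> 'a) measure)"
proof -
  have "U \<in> sets (borel \<Otimes>\<^sub>M borel)" if "open U" for U :: "('a \<times> 'a) set"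
  proof -
    define b where "b u = ball (fst u) (1 / real (Suc (snd u)))" for u :: "'a \<times> nat"
    define P where "P = {(u, v). u \<in> D \<times> UNIV \<and> v \<in> D \<times> UNIV \<and> b u \<times> b v \<subseteq> U}"
    have "countable P"
      by (rule countable_subset[of _ "(D \<times> UNIV) \<times> (D \<times> UNIV)"]) (auto simp: P_def assms(1))
    moreover have "U = (\<Union>(u, v)\<in>P. b u \<times> b v)"
    proof
      show "U \<subseteq> (\<Union>(u, v)\<in>P. b u \<times> b v)"
      proof
        fix w assume "w \<in> U"
        then obtain S T where ST: "open S" "open T" "w \<in> S \<times> T" "S \<times> T \<subseteq> U"
          using \<open>open U\<close> open_prod_def by metis
        obtain d m where "d \<in> D" "fst w \<in> b (d, m)" "b (d, m) \<subseteq> S"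
          using countable_dense_ball_base[OF D ST(1), of "fst w"] ST(3) by (auto simp: b_def)
        moreover obtain e k where "e \<in> D" "snd w \<in> b (e, k)" "b (e, k) \<subseteq> T"
          using countable_dense_ball_base[OF D ST(2), of "snd w"] ST(3) by (auto simp: b_def)
        ultimately have "((d, m), (e, k)) \<in> P \<and> w \<in> b (d, m) \<times> b (e, k)" 
          using ST(4) by (cases w) (auto simp: P_def)
        then show "w \<in> (\<Union>(u, v)\<in>P. b u \<times> b v)" by (intro UN_I[of "((d, m), (e, k))"]) simp_all
      qed
    qed (auto simp: P_def)
    moreover have "b u \<times> b v \<in> sets (borel \<Otimes>\<^sub>M borel)" for u v
      by (intro pair_measureI) (auto simp: b_def)
    ultimately show ?thesis by (auto simp: case_prod_beta intro!: sets.countable_UN'')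
  qed
  moreover have "sets (borel :: ('a \<times> 'a) measure) = sigma_sets UNIV {S. open S}"
    by (simp add: borel_def)
  ultimately show ?thesis
    using sets.sigma_sets_subset[of "{S :: ('a \<times> 'a) set. open S}" "borel \<Otimes>\<^sub>M borel"]
    by (auto simp: space_pair_measure)
qed

text \<open>Greedy selection: a ball of largest radius is kept, and every ball meeting it lies in
  its threefold enlargement because its radius is no larger. The induction treats the balls disjoint
  from it.\<close>

lemma finite_Vitali:
  fixes z :: "'i \<Rightarrow> 'a::metric_space" and r :: "'i \<Rightarrow> real"
  assumes "finite I"
  shows "\<exists>J\<subseteq>I. disjoint_family_on (\<lambda>i. ball (z i) (r i)) J \<and>
           (\<Union>i\<in>I. ball (z i) (r i)) \<subseteq> (\<Union>i\<in>J. ball (z i) (3 * r i))"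
  using assms
proof (induction I rule: finite_psubset_induct)
  case (psubset I)
  show ?case
  proof (cases "I = {}")
    case True
    then show ?thesis by (auto simp: disjoint_family_on_def)
  next
    case False
    obtain m where m: "m \<in> I" "\<And>i. i \<in> I \<Longrightarrow> r i \<le> r m"
      using arg_min_least[OF psubset(1) False, of _ "\<lambda>i. - r i"]
        arg_min_if_finite(1)[OF psubset(1) False, of "\<lambda>i. - r i"] by (metis neg_le_iff_le)
    define I' where "I' = {i \<in> I - {m}. ball (z i) (r i) \<inter> ball (z m) (r m) = {}}"
    have "I' \<subset> I" using m by (auto simp: I'_def)
    from psubset(2)[OF this] obtain J where J: "J \<subseteq> I'" 
      "disjoint_family_on (\<lambda>i. ball (z i) (r i)) J"
      "(\<Union>i\<in>I'. ball (z i) (r i)) \<subseteq> (\<Union>i\<in>J. ball (z i) (3 * r i))" by blast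
    have near: "ball (z i) (r i) \<subseteq> ball (z m) (3 * r m)" if i: "i \<in> I" "ball (z i) (r i) \<inter> ball (z m) (r m) \<noteq> {}" for i
    proof
      fix y assume y: "y \<in> ball (z i) (r i)"
      obtain w where "dist (z i) w < r i" "dist (z m) w < r m" using i(2) by auto
      then show "y \<in> ball (z m) (3 * r m)"
        using y m(2)[OF i(1)] dist_triangle[of "z m" y "z i"] dist_triangle[of "z m" "z i" w]
        by (simp add: dist_commute)
    qed
    \<comment> \<open>The radii are arbitrary reals, so \<open>3 * r m\<close> may be smaller than
      \<open>r m\<close>; the ball is then empty.\<close>
    have self: "ball (z m) (r m) \<subseteq> ball (z m) (3 * r m)"
      by (cases "r m \<le> 0") (simp_all add: ball_empty subset_ball)
    show ?thesis
    proof (intro exI[of _ "insert m J"] conjI)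
      show "insert m J \<subseteq> I" using J(1) m(1) by (auto simp: I'_def)
      show "disjoint_family_on (\<lambda>i. ball (z i) (r i)) (insert m J)"
        using J(1,2) unfolding disjoint_family_on_def I'_def by blast
      show "(\<Union>i\<in>I. ball (z i) (r i)) \<subseteq> (\<Union>i\<in>insert m J. ball (z i) (3 * r i))"
      proof
        fix y assume "y \<in> (\<Union>i\<in>I. ball (z i) (r i))"
        then obtain i where i: "i \<in> I" "y \<in> ball (z i) (r i)" by auto
        then consider "i \<in> I'" | "i = m" | "ball (z i) (r i) \<inter> ball (z m) (r m) \<noteq> {}"
          by (auto simp: I'_def)
        then show "y \<in> (\<Union>i\<in>insert m J. ball (z i) (3 * r i))"
          by cases (use i J(3) near[OF i(1)] self in blast)+
      qed
    qed
  qed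
qed

section \<open>Exhaustion of the space by balls about one point\<close>

lemma UN_balls: "(\<Union>m. ball x (real (Suc m))) = (UNIV :: 'a::metric_space set)"
proof safe
  fix y
  obtain m where "dist x y < real m" using reals_Archimedean2 by blast
  then have "y \<in> ball x (real (Suc m))" by simp
  then show "y \<in> (\<Union>m. ball x (real (Suc m)))" by blast
qed simp

lemma incseq_balls: "incseq (\<lambda>m. ball x (real (Suc m)) :: 'a::metric_space set)"
  by (intro incseq_SucI subset_ball) auto

subsection \<open>The maximal function\<close>

text \<open>The sum over the integers is written as an integral against counting measure so that
  Tonelli applies to it later. Counting down from the floor of \<open>L\<close> turns it into a
  geometric series of ratio \<open>2 powr - a\<close>.\<close>

lemma nn_integral_powr_atMost_int:
  fixes a L :: real
  assumes "a > 0"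
  shows "(\<integral>\<^sup>+k. ennreal (2 powr (real_of_int k * a)) * indicator {k. real_of_int k \<le> L} k \<partial>count_space UNIV)
           \<le> ennreal (2 powr (L * a) / (1 - 2 powr - a))"
proof -
  have "2 powr - a < (1::real)" using assms by (simp add: powr_less_one)
  have bij: "bij_betw (\<lambda>j. \<lfloor>L\<rfloor> - int j) UNIV {k. real_of_int k \<le> L}"
    by (rule bij_betwI[where g="\<lambda>k. nat (\<lfloor>L\<rfloor> - k)"]) (auto simp: le_floor_iff, linarith)
  have "(\<integral>\<^sup>+k. ennreal (2 powr (real_of_int k * a)) * indicator {k. real_of_int k \<le> L} k \<partial>count_space UNIV)
      = (\<integral>\<^sup>+k. ennreal (2 powr (real_of_int k * a)) \<partial>count_space {k. real_of_int k \<le> L})"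
    by (subst nn_integral_count_space_indicator) auto
  also have "\<dots> = (\<integral>\<^sup>+j. ennreal (2 powr (real_of_int (\<lfloor>L\<rfloor> - int j) * a)) \<partial>count_space UNIV)"
    by (rule nn_integral_bij_count_space[OF bij, symmetric])
  also have "\<dots> = (\<Sum>j. ennreal (2 powr (\<lfloor>L\<rfloor> * a) * (2 powr - a) ^ j))"
    unfolding nn_integral_count_space_nat
    by (intro suminf_cong arg_cong[of _ _ ennreal])
       (simp add: powr_power powr_add[symmetric] algebra_simps)
  also have "\<dots> = ennreal (2 powr (\<lfloor>L\<rfloor> * a) * (1 / (1 - 2 powr - a)))"
    using \<open>2 powr - a < 1\<close>
    by (intro suminf_ennreal_eq sums_mult geometric_sums) auto
  also have "\<dots> \<le> ennreal (2 powr (L * a) / (1 - 2 powr - a))"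
    using \<open>2 powr - a < 1\<close> assms
    by (intro ennreal_leI) (auto intro!: divide_right_mono powr_mono mult_right_mono)
  finally show ?thesis .
qed

lemma nn_integral_powr_atLeast_int:
  fixes a L :: real
  assumes "a > 0"
  shows "(\<integral>\<^sup>+k. ennreal (2 powr (- real_of_int k * a)) * indicator {k. L \<le> real_of_int k} k \<partial>count_space UNIV)
           \<le> ennreal (2 powr (- L * a) / (1 - 2 powr - a))"
proof -
  have "bij (uminus :: int \<Rightarrow> int)" by (rule bij_uminus)
  have "(\<integral>\<^sup>+k. ennreal (2 powr (- real_of_int k * a)) * indicator {k. L \<le> real_of_int k} k \<partial>count_space UNIV)
     = (\<integral>\<^sup>+k. ennreal (2 powr (real_of_int k * a)) * indicator {k. real_of_int k \<le> - L} k \<partial>count_space UNIV)"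
    by (subst nn_integral_bij_count_space[OF \<open>bij uminus\<close>, symmetric])
       (auto simp: indicator_def intro!: nn_integral_cong)
  then show ?thesis using nn_integral_powr_atMost_int[OF assms, of "- L"] by simp
qed

text \<open>Geometric doubling enters as separability of the space, upper doubling with one fixed
  constant \<open>Cd\<close> for the passage from \<open>r\<close> to \<open>2 * r\<close>.\<close>

locale upper_doubling_measure =
  fixes M :: "'a::metric_space measure" and lam :: "'a \<Rightarrow> real \<Rightarrow> real" and Cd :: real
  assumes sets_M: "sets M = sets borel"
    and lam_pos: "\<And>x r. r > 0 \<Longrightarrow> lam x r > 0"
    and lam_mono: "\<And>x r s. 0 < r \<Longrightarrow> r \<le> s \<Longrightarrow> lam x r \<le> lam x s"
    and lam_double: "\<And>x r. r > 0 \<Longrightarrow> lam x (2 * r) \<le> Cd * lam x r"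
    and emeasure_ball: "\<And>x r. r > 0 \<Longrightarrow> emeasure M (ball x r) \<le> ennreal (lam x r)"
    and separable: "\<exists>D::'a set. countable D \<and> (\<forall>x. \<forall>e>0. \<exists>d\<in>D. dist d x < e)"
begin

lemma space_M [simp]: "space M = UNIV"
  using sets_eq_imp_space_eq[OF sets_M] by simp

lemma open_in_sets [measurable (raw)]: "open U \<Longrightarrow> U \<in> sets M"
  by (simp add: sets_M)

lemma Cd_pos: "Cd > 0"
proof -
  have "0 < lam undefined 2" "lam undefined 2 \<le> Cd * lam undefined 1" "0 < lam undefined 1"
    using lam_pos lam_double[of 1 undefined] by auto
  then show ?thesis by (metis less_le_trans zero_less_mult_pos2)
qed

text \<open>The factor 4 absorbs the enlargement by 3 in the covering lemma, and in
  \<open>level_set_cover\<close> the passage from a radius above \<open>S / 2\<close> to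
  \<open>2 * S\<close>.\<close>

lemma lam_quadruple: "r > 0 \<Longrightarrow> lam x (4 * r) \<le> Cd\<^sup>2 * lam x r"
proof -
  assume "r > 0"
  then have "lam x (2 * (2 * r)) \<le> Cd * lam x (2 * r)" by (intro lam_double) simp
  also have "\<dots> \<le> Cd * (Cd * lam x r)" using Cd_pos lam_double[OF \<open>r > 0\<close>] by (intro mult_left_mono) auto
  finally show ?thesis by (simp add: power2_eq_square mult.assoc)
qed

lemma sigma_finite_M: "sigma_finite_measure M"
proof
  define x :: 'a where "x = undefined"
  show "\<exists>A. countable A \<and> A \<subseteq> sets M \<and> \<Union> A = space M \<and> (\<forall>a\<in>A. emeasure M a \<noteq> \<infinity>)"
  proof (intro exI[of _ "range (\<lambda>m. ball x (real (Suc m)))"] conjI ballI)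
    show "\<Union> (range (\<lambda>m. ball x (real (Suc m)))) = space M" using UN_balls[of x] by simp
    fix a assume "a \<in> range (\<lambda>m. ball x (real (Suc m)))"
    then obtain m where "a = ball x (real (Suc m))" by blast
    then have "emeasure M a \<le> ennreal (lam x (real (Suc m)))" using emeasure_ball by simp
    then show "emeasure M a \<noteq> \<infinity>" by (auto simp: top_unique)
  qed (auto simp: open_in_sets)
qed

text \<open>Tonelli for a sum over the integers; as the index set is countable, joint measurability
  follows from that of each \<open>f k\<close>.\<close>

lemma nn_integral_swap_int:
  assumes "\<And>k::int. f k \<in> borel_measurable M"
  shows "(\<integral>\<^sup>+x. \<integral>\<^sup>+k. f k x \<partial>count_space UNIV \<partial>M) = (\<integral>\<^sup>+k. \<integral>\<^sup>+x. f k x \<partial>M \<partial>count_space UNIV)"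
proof -
  interpret pair_sigma_finite "count_space (UNIV :: int set)" M
    by (rule pair_sigma_finite.intro[OF sigma_finite_measure_count_space sigma_finite_M])
  have "(\<lambda>(k, x). f k x) \<in> borel_measurable (count_space UNIV \<Otimes>\<^sub>M M)"
    using assms by (intro measurable_pair_measure_countable1) simp_all
  then show ?thesis by (rule Fubini')
qed

text \<open>The superlevel set of the maximal function of \<open>\<nu>\<close> over all balls containing the point, not only
  those centred at it: this makes it open, although \<open>lam\<close> need not be measurable in the point.\<close>

definition maximal_level :: "'a measure \<Rightarrow> real \<Rightarrow> 'a set" where
  "maximal_level \<nu> t =
     (\<Union>(z, r)\<in>{(z, r). r > 0 \<and> ennreal (t * lam z r) < emeasure \<nu> (ball z r)}. ball z r)"

lemma open_maximal_level: "open (maximal_level \<nu> t)"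
  unfolding maximal_level_def by (intro open_UN) auto

text \<open>For each ball selected by the covering lemma, the measure of its threefold enlargement
  is at most \<open>Cd\<^sup>2 * lam z r\<close>, hence at most \<open>Cd\<^sup>2 / t\<close> times
  its \<open>\<nu>\<close>-mass; disjointness sums these masses to at most the total mass.\<close>

lemma maximal_level_weak_type:
  assumes \<nu>: "sets \<nu> = sets borel" and "t > 0"
  shows "emeasure M (maximal_level \<nu> t) \<le> ennreal (Cd\<^sup>2 / t) * emeasure \<nu> UNIV"
proof -
  define I where "I = {(z, r). r > 0 \<and> ennreal (t * lam z r) < emeasure \<nu> (ball z r)}"
  define b where "b u = ball (fst u) (snd u)" for u :: "'a \<times> real"
  have fin: "emeasure M (\<Union>i\<in>F. b i) \<le> ennreal (Cd\<^sup>2 / t) * emeasure \<nu> UNIV" if F: "finite F" "F \<subseteq> I" for F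
  proof -
    from finite_Vitali[OF F(1), of fst snd] obtain J where J: "J \<subseteq> F"
      "disjoint_family_on b J" "(\<Union>i\<in>F. b i) \<subseteq> (\<Union>i\<in>J. ball (fst i) (3 * snd i))"
      unfolding b_def by blast
    have "finite J" using J(1) F(1) by (rule finite_subset)
    have "emeasure M (\<Union>i\<in>F. b i) \<le> emeasure M (\<Union>i\<in>J. ball (fst i) (3 * snd i))"
      using J(3) by (intro emeasure_mono open_in_sets) auto
    also have "\<dots> \<le> (\<Sum>i\<in>J. emeasure M (ball (fst i) (3 * snd i)))"
      using \<open>finite J\<close> by (intro emeasure_subadditive_finite) (auto intro: open_in_sets)
    also have "\<dots> \<le> (\<Sum>i\<in>J. ennreal (Cd\<^sup>2 / t) * emeasure \<nu> (b i))"
    proof (rule sum_mono)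
      fix i assume "i \<in> J"
      then have i: "snd i > 0" "ennreal (t * lam (fst i) (snd i)) < emeasure \<nu> (b i)"
        using J(1) F(2) by (auto simp: I_def b_def)
      have "emeasure M (ball (fst i) (3 * snd i)) \<le> ennreal (lam (fst i) (3 * snd i))"
        using i by (intro emeasure_ball) auto
      also have "\<dots> \<le> ennreal (Cd\<^sup>2 * lam (fst i) (snd i))"
        using i(1) lam_mono[of "3 * snd i" "4 * snd i" "fst i"] lam_quadruple[of "snd i" "fst i"]
        by (intro ennreal_leI) auto
      also have "\<dots> = ennreal (Cd\<^sup>2 / t) * ennreal (t * lam (fst i) (snd i))"
        using \<open>t > 0\<close> by (subst ennreal_mult'[symmetric]) auto
      also have "\<dots> \<le> ennreal (Cd\<^sup>2 / t) * emeasure \<nu> (b i)"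
        using i(2) by (intro mult_left_mono) auto
      finally show "emeasure M (ball (fst i) (3 * snd i)) \<le> ennreal (Cd\<^sup>2 / t) * emeasure \<nu> (b i)" .
    qed
    also have "\<dots> = ennreal (Cd\<^sup>2 / t) * emeasure \<nu> (\<Union>i\<in>J. b i)"
    proof -
      have "b ` J \<subseteq> sets \<nu>" by (auto simp: \<nu> b_def)
      from sum_emeasure[OF this J(2) \<open>finite J\<close>] show ?thesis by (simp add: sum_distrib_left[symmetric])
    qed
    also have "\<dots> \<le> ennreal (Cd\<^sup>2 / t) * emeasure \<nu> UNIV"
      using sets_eq_imp_space_eq[OF \<nu>] emeasure_space[of \<nu>] by (intro mult_left_mono) auto
    finally show ?thesis .
  qed
  \<comment> \<open>The family of balls is uncountable: Lindelof leaves a countable subfamily, and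
    continuity from below along the finite unions \<open>A m\<close> reduces the claim to
    \<open>fin\<close>.\<close>
  obtain D :: "'a set" where "countable D" "\<forall>x. \<forall>e>0. \<exists>d\<in>D. dist d x < e" using separable by blast
  from countable_dense_Lindelof[OF this, of I b] obtain J where
    J: "J \<subseteq> I" "countable J" "(\<Union>i\<in>I. b i) = (\<Union>i\<in>J. b i)" by (auto simp: b_def)
  have level: "maximal_level \<nu> t = (\<Union>i\<in>J. b i)"
    unfolding J(3)[symmetric] by (auto simp: maximal_level_def I_def b_def)
  show ?thesis
  proof (cases "J = {}")
    case True
    then show ?thesis by (simp add: level)
  next
    case False
    define A where "A m = (\<Union>i\<in>from_nat_into J ` {..m}. b i)" for m
    have "(\<Union>m. A m) = (\<Union>i\<in>J. b i)"
    proof -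
      have "(\<Union>m. A m) = (\<Union>i\<in>range (from_nat_into J). b i)" by (auto simp: A_def)
      then show ?thesis using range_from_nat_into[OF False J(2)] by simp
    qed
    moreover have "(SUP m. emeasure M (A m)) = emeasure M (\<Union>m. A m)"
    proof (rule SUP_emeasure_incseq)
      show "range A \<subseteq> sets M" by (auto simp: A_def b_def intro!: open_in_sets)
      show "incseq A" unfolding A_def incseq_def by (intro allI impI UN_mono image_mono) auto
    qed
    moreover have "emeasure M (A m) \<le> ennreal (Cd\<^sup>2 / t) * emeasure \<nu> UNIV" for m
      unfolding A_def using from_nat_into[OF False] J(1) by (intro fin) auto
    ultimately show ?thesis unfolding level using SUP_least[of UNIV "\<lambda>m. emeasure M (A m)"] by simp
  qed
qed

text \<open>The part of \<open>h\<close> not exceeding \<open>t / 2\<close> contributes at most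
  \<open>t / 2 * lam z r\<close> to a ball, so on a ball counted at height \<open>t\<close> the rest
  of \<open>h\<close> has mass above \<open>t / 2 * lam z r\<close>. The weak type bound is then
  applied to that rest, as in Marcinkiewicz interpolation.\<close>

lemma maximal_level_truncated:
  fixes h :: "'a \<Rightarrow> real"
  assumes h[measurable]: "h \<in> borel_measurable M" and "t > 0"
  shows "emeasure M (maximal_level (density M (\<lambda>x. ennreal (h x))) t)
           \<le> ennreal (2 * Cd\<^sup>2 / t) * (\<integral>\<^sup>+x. ennreal (h x) * indicator {x. t / 2 < h x} x \<partial>M)"
proof -
  define \<nu> where "\<nu> = density M (\<lambda>x. ennreal (h x))"
  define \<nu>' where "\<nu>' = density M (\<lambda>x. ennreal (h x) * indicator {x. t / 2 < h x} x)"
  have split: "emeasure \<nu> B \<le> emeasure \<nu>' B + ennreal (t / 2) * emeasure M B" if [measurable]: "B \<in> sets M" for B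
  proof -
    have "emeasure \<nu> B = (\<integral>\<^sup>+x. ennreal (h x) * indicator B x \<partial>M)"
      by (simp add: \<nu>_def emeasure_density)
    also have "\<dots> \<le> (\<integral>\<^sup>+x. ennreal (h x) * indicator {x. t / 2 < h x} x * indicator B x
                         + ennreal (t / 2) * indicator B x \<partial>M)"
      by (intro nn_integral_mono) (auto simp: indicator_def intro: ennreal_leI)
    also have "\<dots> = emeasure \<nu>' B + ennreal (t / 2) * emeasure M B"
      by (subst nn_integral_add) (simp_all add: \<nu>'_def emeasure_density nn_integral_cmult_indicator)
    finally show ?thesis .
  qed
  have "maximal_level \<nu> t \<subseteq> maximal_level \<nu>' (t / 2)"
  proof
    fix x assume "x \<in> maximal_level \<nu> t"
    then obtain z r where zr: "r > 0" "ennreal (t * lam z r) < emeasure \<nu> (ball z r)" "x \<in> ball z r"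
      by (auto simp: maximal_level_def)
    have "ennreal (t / 2 * lam z r) < emeasure \<nu>' (ball z r)"
    \<comment> \<open>Arguing by contradiction avoids subtracting extended reals, as the masses may
      be infinite.\<close>
    proof (rule ccontr)
      assume "\<not> ?thesis"
      then have "emeasure \<nu>' (ball z r) \<le> ennreal (t / 2 * lam z r)" by simp
      moreover have "ennreal (t / 2) * emeasure M (ball z r) \<le> ennreal (t / 2) * ennreal (lam z r)"
        using emeasure_ball[OF zr(1)] by (intro mult_left_mono) auto
      then have "ennreal (t / 2) * emeasure M (ball z r) \<le> ennreal (t / 2 * lam z r)"
        using \<open>t > 0\<close> lam_pos[OF zr(1), of z] by (subst ennreal_mult) auto
      ultimately have "emeasure \<nu>' (ball z r) + ennreal (t / 2) * emeasure M (ball z r)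
          \<le> ennreal (t / 2 * lam z r) + ennreal (t / 2 * lam z r)" by (rule add_mono)
      also have "\<dots> = ennreal (t * lam z r)"
        using \<open>t > 0\<close> lam_pos[OF zr(1), of z] by (simp flip: ennreal_plus)
      finally show False using split[OF open_in_sets[OF open_ball], of z r] zr(2) by simp
    qed
    then show "x \<in> maximal_level \<nu>' (t / 2)"
      using zr unfolding maximal_level_def by blast
  qed
  then have "emeasure M (maximal_level \<nu> t) \<le> emeasure M (maximal_level \<nu>' (t / 2))"
    by (intro emeasure_mono open_in_sets open_maximal_level)
  also have "\<dots> \<le> ennreal (Cd\<^sup>2 / (t / 2)) * emeasure \<nu>' UNIV"
    using \<open>t > 0\<close> by (intro maximal_level_weak_type) (auto simp: \<nu>'_def sets_M)
  also have "emeasure \<nu>' UNIV = (\<integral>\<^sup>+x. ennreal (h x) * indicator {x. t / 2 < h x} x \<partial>M)"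
  proof -
    have "UNIV \<in> sets M" by (simp add: sets_M)
    then show ?thesis by (simp add: \<nu>'_def emeasure_density)
  qed
  finally show ?thesis by (simp add: \<nu>_def mult.commute)
qed

text \<open>Only \<open>k\<close> with \<open>2 powr k < 2 * b\<close> contribute, and the summands
  grow with ratio \<open>2 powr (p - 1)\<close>. As \<open>p > 1\<close>, the last one dominates and
  is of order \<open>b powr p\<close>. The \<open>b\<close> inside the set is a bound variable of
  its own.\<close>

lemma dyadic_layer_sum:
  fixes p c b :: real
  assumes "p > 1" and "c \<ge> 0" and "b \<ge> 0"
  shows "(\<integral>\<^sup>+k. ennreal (2 powr ((real_of_int k + 1) * p)) *
             (ennreal (c / 2 powr real_of_int k) * (ennreal b * indicator {b. 2 powr real_of_int k / 2 < b} b)) \<partial>count_space UNIV)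
           \<le> ennreal (c * 2 powr (2 * p - 1) / (1 - 2 powr - (p - 1)) * b powr p)"
proof (cases "b = 0")
  case False
  with assms have "b > 0" by simp
  define L where "L = log 2 b + 1"
  have "2 powr real_of_int k / 2 < b \<Longrightarrow> real_of_int k \<le> L" for k
  proof -
    assume "2 powr real_of_int k / 2 < b"
    then have "2 powr (real_of_int k - 1) < b" by (simp add: powr_diff)
    then have "real_of_int k - 1 < log 2 b" using \<open>b > 0\<close> by (simp add: less_log_iff)
    then show ?thesis by (simp add: L_def)
  qed
  then have "(\<integral>\<^sup>+k. ennreal (2 powr ((real_of_int k + 1) * p)) *
             (ennreal (c / 2 powr real_of_int k) * (ennreal b * indicator {b. 2 powr real_of_int k / 2 < b} b)) \<partial>count_space UNIV)
    \<le> (\<integral>\<^sup>+k. ennreal (c * 2 powr p * b) * (ennreal (2 powr (real_of_int k * (p - 1))) * indicator {k. real_of_int k \<le> L} k) \<partial>count_space UNIV)"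
    using assms
    by (intro nn_integral_mono)
       (auto simp: indicator_def ennreal_mult[symmetric] powr_add powr_diff algebra_simps divide_simps intro!: ennreal_leI)
  also have "\<dots> \<le> ennreal (c * 2 powr p * b) * ennreal (2 powr (L * (p - 1)) / (1 - 2 powr - (p - 1)))"
    using assms nn_integral_powr_atMost_int[of "p - 1" L]
    by (subst nn_integral_cmult) (auto intro: mult_left_mono)
  also have "2 powr (L * (p - 1)) = b powr (p - 1) * 2 powr (p - 1)"
    using \<open>b > 0\<close> by (simp add: L_def distrib_right powr_add powr_powr[symmetric])
  also have "ennreal (c * 2 powr p * b) * ennreal (b powr (p - 1) * 2 powr (p - 1) / (1 - 2 powr - (p - 1)))
     = ennreal (c * 2 powr p * b * (b powr (p - 1) * 2 powr (p - 1) / (1 - 2 powr - (p - 1))))"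
    using assms by (intro ennreal_mult[symmetric]) (auto simp: powr_less_one less_imp_le)
  also have "c * 2 powr p * b * (b powr (p - 1) * 2 powr (p - 1) / (1 - 2 powr - (p - 1)))
     = c * (2 powr p * 2 powr (p - 1)) / (1 - 2 powr - (p - 1)) * (b * b powr (p - 1))"
    by simp
  also have "2 powr p * 2 powr (p - 1) = 2 powr (2 * p - 1)" by (simp add: powr_add[symmetric])
  also have "b * b powr (p - 1) = b powr p" using \<open>b > 0\<close> by (simp add: powr_mult_base)
  finally show ?thesis .
qed simp

text \<open>The layer-cake sum \<open>G\<close> over dyadic superlevel sets dominates the
  \<open>p\<close>-th power of the maximal function, and its integral is bounded by
  \<open>maximal_level_truncated\<close>, Tonelli and \<open>dyadic_layer_sum\<close>. Its
  \<open>p\<close>-th root \<open>g\<close> is measurable and stands in for the maximal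
  function.\<close>

lemma maximal_strong_type:
  fixes h :: "'a \<Rightarrow> real" and p :: real
  assumes h[measurable]: "h \<in> borel_measurable M" and h0: "\<And>x. h x \<ge> 0" and p: "p > 1"
    and fin: "(\<integral>\<^sup>+x. ennreal (h x powr p) \<partial>M) < \<infinity>"
  shows "\<exists>g\<in>borel_measurable M. (\<forall>x. 0 \<le> g x) \<and>
    (AE x in M. \<forall>z r. r > 0 \<longrightarrow> x \<in> ball z r \<longrightarrow>
        emeasure (density M (\<lambda>x. ennreal (h x))) (ball z r) \<le> ennreal (lam z r * g x)) \<and>
    (\<integral>\<^sup>+x. ennreal (g x powr p) \<partial>M)
       \<le> ennreal (Cd\<^sup>2 * 2 powr (2 * p) / (1 - 2 powr - (p - 1))) * (\<integral>\<^sup>+x. ennreal (h x powr p) \<partial>M)"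
proof -
  define \<nu> where "\<nu> = density M (\<lambda>x. ennreal (h x))"
  define U where "U k = maximal_level \<nu> (2 powr real_of_int k)" for k
  have [measurable]: "U k \<in> sets M" for k unfolding U_def by (intro open_in_sets open_maximal_level)
  \<comment> \<open>The exponent uses \<open>k + 1\<close> so that level \<open>k\<close> alone
    already dominates values of the maximal function up to \<open>2 powr (k + 1)\<close>.\<close>
  define G where "G x = (\<integral>\<^sup>+k. ennreal (2 powr ((real_of_int k + 1) * p)) * indicator (U k) x \<partial>count_space UNIV)" for x
  define c where "c = Cd\<^sup>2 * 2 powr (2 * p) / (1 - 2 powr - (p - 1))"
  have Gm[measurable]: "G \<in> borel_measurable M"
    unfolding G_def
    by (intro sigma_finite_measure.borel_measurable_nn_integral[OF sigma_finite_measure_count_space])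
       (auto simp: case_prod_beta intro!: measurable_pair_measure_countable1)
  have "(\<integral>\<^sup>+x. G x \<partial>M) = (\<integral>\<^sup>+k. ennreal (2 powr ((real_of_int k + 1) * p)) * emeasure M (U k) \<partial>count_space UNIV)"
    unfolding G_def by (subst nn_integral_swap_int) (simp_all add: nn_integral_cmult_indicator)
  also have "\<dots> \<le> (\<integral>\<^sup>+k. ennreal (2 powr ((real_of_int k + 1) * p)) * (ennreal (2 * Cd\<^sup>2 / 2 powr real_of_int k) *
      (\<integral>\<^sup>+x. ennreal (h x) * indicator {b. 2 powr real_of_int k / 2 < b} (h x) \<partial>M)) \<partial>count_space UNIV)"
    unfolding U_def \<nu>_def
  proof (intro nn_integral_mono mult_left_mono)
    fix k :: int
    \<comment> \<open>Reading the indicator as a function of the value \<open>h x\<close> lets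
      \<open>dyadic_layer_sum\<close> apply pointwise.\<close>
    have "(\<lambda>x. ennreal (h x) * indicator {x. 2 powr real_of_int k / 2 < h x} x)
        = (\<lambda>x. ennreal (h x) * indicator {b. 2 powr real_of_int k / 2 < b} (h x))"
      by (auto simp: indicator_def)
    then show "emeasure M (maximal_level (density M (\<lambda>x. ennreal (h x))) (2 powr real_of_int k))
         \<le> ennreal (2 * Cd\<^sup>2 / 2 powr real_of_int k) *
           (\<integral>\<^sup>+x. ennreal (h x) * indicator {b. 2 powr real_of_int k / 2 < b} (h x) \<partial>M)"
      using maximal_level_truncated[OF h, of "2 powr real_of_int k"] by simp
  qed simp
  also have "\<dots> = (\<integral>\<^sup>+x. \<integral>\<^sup>+k. ennreal (2 powr ((real_of_int k + 1) * p)) * (ennreal (2 * Cd\<^sup>2 / 2 powr real_of_int k) *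
      (ennreal (h x) * indicator {b. 2 powr real_of_int k / 2 < b} (h x))) \<partial>count_space UNIV \<partial>M)"
    by (subst nn_integral_swap_int) (simp_all add: nn_integral_cmult)
  also have "\<dots> \<le> (\<integral>\<^sup>+x. ennreal (2 * Cd\<^sup>2 * 2 powr (2 * p - 1) / (1 - 2 powr - (p - 1)) * h x powr p) \<partial>M)"
    using p h0 by (intro nn_integral_mono dyadic_layer_sum) auto
  also have "2 * Cd\<^sup>2 * 2 powr (2 * p - 1) / (1 - 2 powr - (p - 1)) = c"
    by (simp add: c_def powr_diff)
  also have "(\<integral>\<^sup>+x. ennreal (c * h x powr p) \<partial>M) = ennreal c * (\<integral>\<^sup>+x. ennreal (h x powr p) \<partial>M)"
  proof -
    have "c \<ge> 0" using p by (auto simp: c_def powr_less_one less_imp_le)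
    then show ?thesis by (simp add: ennreal_mult' nn_integral_cmult)
  qed
  finally have G_le: "(\<integral>\<^sup>+x. G x \<partial>M) \<le> ennreal c * (\<integral>\<^sup>+x. ennreal (h x powr p) \<partial>M)" .
  then have "(\<integral>\<^sup>+x. G x \<partial>M) \<noteq> \<infinity>"
    using fin by (metis ennreal_less_top ennreal_mult_less_top infinity_ennreal_def leD top.not_eq_extremum)
  then have G_fin: "AE x in M. G x \<noteq> \<infinity>" by (intro nn_integral_PInf_AE) auto
  \<comment> \<open>\<open>enn2real\<close> sends infinity to 0, so the bound below is claimed only
    where \<open>G x\<close> is finite, which is almost everywhere.\<close>
  define g where "g x = enn2real (G x) powr (1 / p)" for x
  have bound: "emeasure \<nu> (ball z r) \<le> ennreal (lam z r * g x)"
    if "G x \<noteq> \<infinity>" "r > 0" "x \<in> ball z r" for x z r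
  proof (rule ccontr)
    assume "\<not> ?thesis"
    \<comment> \<open>The intermediate value \<open>s\<close> is finite even if the mass of the ball
      is infinite, so it has a dyadic level \<open>k\<close>.\<close>
    then obtain s where s: "ennreal (lam z r * g x) < s" "s < emeasure \<nu> (ball z r)"
      using dense by (metis not_le)
    then obtain s' where s': "s = ennreal s'" "s' \<ge> 0" by (cases s) auto
    have "lam z r > 0" using lam_pos \<open>r > 0\<close> by simp
    have "g x \<ge> 0" by (simp add: g_def)
    have less: "lam z r * g x < s'"
      using s(1) s' by (simp add: ennreal_less_iff \<open>g x \<ge> 0\<close> \<open>lam z r > 0\<close> less_imp_le)
    then have "g x < s' / lam z r" using \<open>lam z r > 0\<close> by (simp add: field_simps)
    then have pos: "s' / lam z r > 0" using \<open>g x \<ge> 0\<close> by linarith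
    define k where "k = \<lfloor>log 2 (s' / lam z r)\<rfloor>"
    have k: "2 powr real_of_int k \<le> s' / lam z r" "s' / lam z r < 2 powr (real_of_int k + 1)"
      using pos by (simp_all add: k_def le_log_iff[symmetric] log_less_iff[symmetric])
    have "ennreal (2 powr real_of_int k * lam z r) \<le> s"
      using k(1) \<open>lam z r > 0\<close> by (auto simp: s' field_simps intro!: ennreal_leI)
    then have "x \<in> U k"
      using s(2) that unfolding U_def maximal_level_def
      by (auto intro!: exI[of _ z] exI[of _ r])
    then have "ennreal (2 powr ((real_of_int k + 1) * p)) \<le> G x"
      using nn_integral_ge_point[of k UNIV "\<lambda>k. ennreal (2 powr ((real_of_int k + 1) * p)) * indicator (U k) x"]
      by (simp add: G_def)
    then have "2 powr ((real_of_int k + 1) * p) \<le> enn2real (G x)"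
      using that(1) by (cases "G x") auto
    then have "(2 powr ((real_of_int k + 1) * p)) powr (1 / p) \<le> g x"
      unfolding g_def using p by (intro powr_mono2) auto
    then have "2 powr (real_of_int k + 1) \<le> g x" using p by (simp add: powr_powr)
    with k(2) \<open>g x < s' / lam z r\<close> show False by simp
  qed
  have "(\<integral>\<^sup>+x. ennreal (g x powr p) \<partial>M) \<le> (\<integral>\<^sup>+x. G x \<partial>M)"
  proof (rule nn_integral_mono)
    fix x
    have "g x powr p = enn2real (G x)" using p by (simp add: g_def powr_powr)
    then show "ennreal (g x powr p) \<le> G x" by (cases "G x") auto
  qed
  with G_le have "(\<integral>\<^sup>+x. ennreal (g x powr p) \<partial>M) \<le> ennreal c * (\<integral>\<^sup>+x. ennreal (h x powr p) \<partial>M)" by simp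
  moreover have "g \<in> borel_measurable M" unfolding g_def by measurable
  moreover have "AE x in M. \<forall>z r. r > 0 \<longrightarrow> x \<in> ball z r \<longrightarrow> emeasure \<nu> (ball z r) \<le> ennreal (lam z r * g x)"
    using G_fin by eventually_elim (use bound in blast)
  ultimately show ?thesis unfolding \<nu>_def c_def by (intro bexI[of _ g]) (auto simp: g_def)
qed

subsection \<open>The Hedberg inequality\<close>

text \<open>If \<open>S\<close> is the supremum of the radii with \<open>lam x r \<le> L\<close>,
  the ball of radius \<open>2 * S\<close> contains the level set and doubling keeps
  \<open>lam\<close> of order \<open>L\<close>; the degenerate cases give the empty set or the whole
  space. The measures are quantified after \<open>B\<close> so that one set serves both
  \<open>M\<close> and a density.\<close>

lemma level_set_cover:
  assumes "L > 0"
  shows "\<exists>B. open B \<and> {y. y \<noteq> x \<and> lam x (dist x y) \<le> L} \<subseteq> B \<and>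
    (\<forall>\<nu> s. sets \<nu> = sets borel \<longrightarrow> s \<ge> 0 \<longrightarrow>
       (\<forall>r>0. emeasure \<nu> (ball x r) \<le> ennreal (lam x r * s)) \<longrightarrow> emeasure \<nu> B \<le> ennreal (Cd\<^sup>2 * L * s))"
proof -
  define R where "R = {r. r > 0 \<and> lam x r \<le> L}"
  consider "R = {}" | "R \<noteq> {}" "bdd_above R" | "\<not> bdd_above R" by metis
  then show ?thesis
  proof cases
    case 1
    then have "{y. y \<noteq> x \<and> lam x (dist x y) \<le> L} \<subseteq> {}" by (auto simp: R_def)
    then show ?thesis by (intro exI[of _ "{}"]) auto
  next
    case 2
    define S where "S = Sup R"
    have "r \<le> S" if "r \<in> R" for r unfolding S_def using that 2 by (intro cSup_upper)
    moreover obtain r0 where "r0 \<in> R" using 2 by blast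
    ultimately have "S > 0" by (force simp: R_def)
    \<comment> \<open>\<open>S\<close> need not belong to \<open>R\<close>, so a radius above
      \<open>S / 2\<close> is used, which gives \<open>2 * S < 4 * r\<close>.\<close>
    then obtain r where r: "r \<in> R" "S / 2 < r" using less_cSup_iff[OF 2, of "S / 2"] by (auto simp: S_def)
    have "lam x (2 * S) \<le> lam x (4 * r)" using r \<open>S > 0\<close> by (intro lam_mono) auto
    also have "\<dots> \<le> Cd\<^sup>2 * lam x r" using r by (intro lam_quadruple) (simp add: R_def)
    also have "\<dots> \<le> Cd\<^sup>2 * L" using r by (intro mult_left_mono) (auto simp: R_def)
    finally have lam_le: "lam x (2 * S) \<le> Cd\<^sup>2 * L" .
    show ?thesis
    proof (intro exI[of _ "ball x (2 * S)"] conjI allI impI)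
      show "{y. y \<noteq> x \<and> lam x (dist x y) \<le> L} \<subseteq> ball x (2 * S)"
      proof safe
        fix y assume "y \<noteq> x" "lam x (dist x y) \<le> L"
        then have "dist x y \<le> S" by (intro \<open>\<And>r. r \<in> R \<Longrightarrow> r \<le> S\<close>) (simp add: R_def)
        then show "y \<in> ball x (2 * S)" using \<open>S > 0\<close> by simp
      qed
      fix \<nu> :: "'a measure" and s :: real
      assume "s \<ge> 0" and "\<forall>r>0. emeasure \<nu> (ball x r) \<le> ennreal (lam x r * s)"
      then have "emeasure \<nu> (ball x (2 * S)) \<le> ennreal (lam x (2 * S) * s)" using \<open>S > 0\<close> by simp
      also have "\<dots> \<le> ennreal (Cd\<^sup>2 * L * s)"
        using lam_le \<open>s \<ge> 0\<close> by (intro ennreal_leI mult_right_mono)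
      finally show "emeasure \<nu> (ball x (2 * S)) \<le> ennreal (Cd\<^sup>2 * L * s)" .
    qed simp
  next
    case 3
    \<comment> \<open>Here \<open>lam x\<close> is bounded by \<open>L\<close>; the detour through
      \<open>4 * s\<close> produces the factor \<open>Cd\<^sup>2\<close> of the other case without a
      lower bound on \<open>Cd\<close>.\<close>
    have lam_le: "lam x r \<le> Cd\<^sup>2 * L" if "r > 0" for r
    proof -
      obtain s where s: "s \<in> R" "r < s" using 3 by (meson bdd_aboveI2 bdd_above_def not_le)
      have "lam x r \<le> lam x (4 * s)" using s \<open>r > 0\<close> by (intro lam_mono) auto
      also have "\<dots> \<le> Cd\<^sup>2 * lam x s" using s by (intro lam_quadruple) (simp add: R_def)
      also have "\<dots> \<le> Cd\<^sup>2 * L" using s by (intro mult_left_mono) (auto simp: R_def)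
      finally show ?thesis .
    qed
    show ?thesis
    proof (intro exI[of _ UNIV] conjI allI impI)
      fix \<nu> :: "'a measure" and s :: real
      assume \<nu>: "sets \<nu> = sets borel" and "s \<ge> 0" and *: "\<forall>r>0. emeasure \<nu> (ball x r) \<le> ennreal (lam x r * s)"
      have "emeasure \<nu> (ball x r) \<le> ennreal (Cd\<^sup>2 * L * s)" if "r > 0" for r
        using *[rule_format, OF that] ennreal_leI[OF mult_right_mono[OF lam_le[OF that] \<open>s \<ge> 0\<close>]]
        by (rule order_trans)
      moreover have "(SUP m. emeasure \<nu> (ball x (real (Suc m)))) = emeasure \<nu> (\<Union>m. ball x (real (Suc m)))"
        by (rule SUP_emeasure_incseq[OF _ incseq_balls]) (auto simp: \<nu>)
      ultimately show "emeasure \<nu> UNIV \<le> ennreal (Cd\<^sup>2 * L * s)"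
        unfolding UN_balls by (metis SUP_least of_nat_0_less_iff zero_less_Suc)
    qed auto
  qed
qed

text \<open>The two reciprocals are the sums of the geometric series below and above the balancing
  scale; the first factor is the constant in the mass bounds on the level sets.\<close>

definition hedberg_const :: "real \<Rightarrow> real \<Rightarrow> real" where
  "hedberg_const p \<theta> = (2 * Cd\<^sup>2 + 1) * (1 / (1 - 2 powr - \<theta>) + 1 / (1 - 2 powr - (1 / p - \<theta>)))"

text \<open>Pointwise \<open>h x \<le> t + t powr (1 - p) * h x powr p\<close>, since beyond
  \<open>t\<close> the power \<open>(h x / t) powr (p - 1)\<close> is at least 1. The free parameter
  \<open>t\<close> makes this a substitute for the Hoelder inequality.\<close>

lemma emeasure_density_le_Young:
  fixes h :: "'a \<Rightarrow> real"
  assumes [measurable]: "h \<in> borel_measurable M" "B \<in> sets M" and h0: "\<And>x. h x \<ge> 0"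
    and "p > 1" and "t > 0" and "D \<ge> 0" "F \<ge> 0"
    and B: "emeasure M B \<le> ennreal D" and F: "(\<integral>\<^sup>+x. ennreal (h x powr p) \<partial>M) \<le> ennreal F"
  shows "emeasure (density M (\<lambda>x. ennreal (h x))) B \<le> ennreal (t * D + t powr (1 - p) * F)"
proof -
  have *: "h x \<le> t + t powr (1 - p) * h x powr p" for x
  proof (cases "h x \<le> t")
    case False
    then have "1 \<le> (h x / t) powr (p - 1)" using assms by (intro ge_one_powr_ge_zero) auto
    also have "\<dots> = t powr (1 - p) * h x powr (p - 1)"
      using assms False by (simp add: powr_divide powr_minus_divide[of t "p - 1", simplified])
    finally have "h x * 1 \<le> h x * (t powr (1 - p) * h x powr (p - 1))"
      using h0 by (intro mult_left_mono) auto
    also have "\<dots> = t powr (1 - p) * h x powr p"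
      using powr_mult_base[of "h x" "p - 1"] h0 by simp
    finally show ?thesis using \<open>t > 0\<close> by simp
  qed (use \<open>t > 0\<close> in \<open>auto intro: add_increasing2\<close>)
  have "emeasure (density M (\<lambda>x. ennreal (h x))) B = (\<integral>\<^sup>+x. ennreal (h x) * indicator B x \<partial>M)"
    by (simp add: emeasure_density)
  also have "\<dots> \<le> (\<integral>\<^sup>+x. ennreal t * indicator B x + ennreal (t powr (1 - p)) * ennreal (h x powr p) \<partial>M)"
    using * \<open>t > 0\<close>
    by (intro nn_integral_mono)
       (auto simp: indicator_def simp flip: ennreal_mult ennreal_plus intro!: ennreal_leI)
  also have "\<dots> = ennreal t * emeasure M B + ennreal (t powr (1 - p)) * (\<integral>\<^sup>+x. ennreal (h x powr p) \<partial>M)"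
    by (subst nn_integral_add) (simp_all add: nn_integral_cmult nn_integral_cmult_indicator)
  also have "\<dots> \<le> ennreal t * ennreal D + ennreal (t powr (1 - p)) * ennreal F"
    using B F by (intro add_mono mult_left_mono) auto
  also have "\<dots> = ennreal (t * D + t powr (1 - p) * F)"
    using assms by (simp flip: ennreal_mult ennreal_plus)
  finally show ?thesis .
qed

text \<open>Where \<open>lam x (dist x y)\<close> exceeds \<open>2 powr j\<close>, the kernel is at
  most \<open>C0 * 2 powr (- j * (1 - \<theta>))\<close>. Times \<open>\<nu>B1\<close> this grows
  like \<open>2 powr (j * \<theta>)\<close>, times \<open>\<nu>B2\<close> it decays like
  \<open>2 powr (- j * \<delta>)\<close>; the first is summed up to \<open>L\<close>, the second
  from \<open>L\<close> on.\<close>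

lemma Hedberg_inequality:
  fixes h k :: "'a \<Rightarrow> real"
  assumes h[measurable]: "h \<in> borel_measurable M" and h0: "\<And>x. h x \<ge> 0"
    and k: "\<And>y. y \<noteq> x \<Longrightarrow> k y \<le> C0 / lam x (dist x y) powr (1 - \<theta>)" and "C0 \<ge> 0"
    and p: "p > 1" and \<theta>: "0 < \<theta>" "\<theta> < 1 / p" and "A > 0" and "g > 0"
    and A: "(\<integral>\<^sup>+x. ennreal (h x powr p) \<partial>M) \<le> ennreal (A powr p)"
    and g: "\<And>r. r > 0 \<Longrightarrow> emeasure (density M (\<lambda>x. ennreal (h x))) (ball x r) \<le> ennreal (lam x r * g)"
  shows "(\<integral>\<^sup>+y. ennreal (k y * h y) * indicator (- {x}) y \<partial>M)
     \<le> ennreal (C0 * hedberg_const p \<theta> * (A powr (p * \<theta>) * g powr (1 - p * \<theta>)))"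
proof -
  define \<nu> where "\<nu> = density M (\<lambda>x. ennreal (h x))"
  have sets_\<nu>: "sets \<nu> = sets borel" by (simp add: \<nu>_def sets_M)
  \<comment> \<open>The summand \<open>2 * Cd\<^sup>2\<close> comes from
    \<open>level_set_cover\<close> at height \<open>2 powr (j + 1)\<close>, the 1 from the second
    term of \<open>emeasure_density_le_Young\<close>.\<close>
  define D where "D = 2 * Cd\<^sup>2 + 1"
  \<comment> \<open>the scale at which the two bounds \<open>\<nu>B1\<close> and \<open>\<nu>B2\<close> below balance\<close>
  define L where "L = p * log 2 (A / g)"
  define \<delta> where "\<delta> = 1 / p - \<theta>"
  have "\<delta> > 0" using \<theta> by (simp add: \<delta>_def)
  have "D > 0" by (simp add: D_def add_nonneg_pos)
  have "\<forall>j::int. \<exists>B. open B \<and> {y. y \<noteq> x \<and> lam x (dist x y) \<le> 2 powr (real_of_int j + 1)} \<subseteq> B \<and>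
    (\<forall>\<nu> s. sets \<nu> = sets borel \<longrightarrow> s \<ge> 0 \<longrightarrow>
       (\<forall>r>0. emeasure \<nu> (ball x r) \<le> ennreal (lam x r * s)) \<longrightarrow>
         emeasure \<nu> B \<le> ennreal (Cd\<^sup>2 * 2 powr (real_of_int j + 1) * s))"
    by (intro allI level_set_cover) simp
  from choice[OF this] obtain B :: "int \<Rightarrow> 'a set" where B_all:
    "\<forall>j. open (B j) \<and> {y. y \<noteq> x \<and> lam x (dist x y) \<le> 2 powr (real_of_int j + 1)} \<subseteq> B j \<and>
    (\<forall>\<nu> s. sets \<nu> = sets borel \<longrightarrow> s \<ge> 0 \<longrightarrow>
       (\<forall>r>0. emeasure \<nu> (ball x r) \<le> ennreal (lam x r * s)) \<longrightarrow>
         emeasure \<nu> (B j) \<le> ennreal (Cd\<^sup>2 * 2 powr (real_of_int j + 1) * s))" ..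
  have B: "open (B j)"
    "{y. y \<noteq> x \<and> lam x (dist x y) \<le> 2 powr (real_of_int j + 1)} \<subseteq> B j"
    "\<And>\<nu> s. sets \<nu> = sets borel \<Longrightarrow> s \<ge> 0 \<Longrightarrow>
       (\<And>r. r > 0 \<Longrightarrow> emeasure \<nu> (ball x r) \<le> ennreal (lam x r * s)) \<Longrightarrow>
         emeasure \<nu> (B j) \<le> ennreal (Cd\<^sup>2 * 2 powr (real_of_int j + 1) * s)" for j
    using B_all[rule_format, of j] by simp_all
  have [measurable]: "B j \<in> sets M" for j using B(1) by (rule open_in_sets)
  \<comment> \<open>The measure \<open>M\<close> itself satisfies the ball condition with
    \<open>s = 1\<close>.\<close>
  have \<mu>B: "emeasure M (B j) \<le> ennreal (2 * Cd\<^sup>2 * 2 powr real_of_int j)" for j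
    using B(3)[OF sets_M, of 1 j] emeasure_ball[of _ x] by (simp add: powr_add mult_ac)
  have \<nu>B1: "emeasure \<nu> (B j) \<le> ennreal (D * 2 powr real_of_int j * g)" for j
  proof -
    have "emeasure \<nu> (B j) \<le> ennreal (Cd\<^sup>2 * 2 powr (real_of_int j + 1) * g)"
      using \<open>g > 0\<close> g by (intro B(3) sets_\<nu>) (auto simp: \<nu>_def)
    also have "\<dots> \<le> ennreal (D * 2 powr real_of_int j * g)"
      using \<open>g > 0\<close> by (intro ennreal_leI) (simp add: D_def powr_add algebra_simps)
    finally show ?thesis .
  qed
  have \<nu>B2: "emeasure \<nu> (B j) \<le> ennreal (D * 2 powr (real_of_int j * (1 - 1 / p)) * A)" for j
  proof -
    \<comment> \<open>With this \<open>t\<close>, both \<open>t * 2 powr j\<close> and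
      \<open>t powr (1 - p) * A powr p\<close> equal
      \<open>2 powr (j * (1 - 1 / p)) * A\<close>.\<close>
    define t where "t = 2 powr (- real_of_int j / p) * A"
    have "t > 0" using \<open>A > 0\<close> by (simp add: t_def)
    have "emeasure \<nu> (B j) \<le> ennreal (t * (2 * Cd\<^sup>2 * 2 powr real_of_int j) + t powr (1 - p) * A powr p)"
      unfolding \<nu>_def using \<open>t > 0\<close> p by (intro emeasure_density_le_Young \<mu>B A h0) auto
    also have "t * (2 * Cd\<^sup>2 * 2 powr real_of_int j) + t powr (1 - p) * A powr p
        = 2 * Cd\<^sup>2 * A * (2 powr (- real_of_int j / p) * 2 powr real_of_int j)
          + 2 powr (- real_of_int j / p * (1 - p)) * (A powr (1 - p) * A powr p)"
      using \<open>A > 0\<close> by (simp add: t_def powr_mult powr_powr)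
    also have "2 powr (- real_of_int j / p) * 2 powr real_of_int j = 2 powr (real_of_int j * (1 - 1 / p))"
      by (simp add: powr_add[symmetric] algebra_simps)
    also have "- real_of_int j / p * (1 - p) = real_of_int j * (1 - 1 / p)"
      using p by (simp add: field_simps)
    also have "A powr (1 - p) * A powr p = A" using \<open>A > 0\<close> by (simp add: powr_add[symmetric])
    finally show ?thesis by (simp add: D_def algebra_simps)
  qed
  have "(\<integral>\<^sup>+y. ennreal (k y * h y) * indicator (- {x}) y \<partial>M)
      \<le> (\<integral>\<^sup>+y. \<integral>\<^sup>+j. ennreal (C0 * 2 powr (- real_of_int j * (1 - \<theta>))) * (ennreal (h y) * indicator (B j) y)
            \<partial>count_space UNIV \<partial>M)"
  proof (rule nn_integral_mono)
    fix y
    show "ennreal (k y * h y) * indicator (- {x}) y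
       \<le> (\<integral>\<^sup>+j. ennreal (C0 * 2 powr (- real_of_int j * (1 - \<theta>))) * (ennreal (h y) * indicator (B j) y)
            \<partial>count_space UNIV)"
    proof (cases "y = x")
      case False
      define l where "l = lam x (dist x y)"
      have "l > 0" using False lam_pos by (simp add: l_def)
      \<comment> \<open>The ceiling minus 1 puts \<open>l\<close> above \<open>2 powr j\<close>,
        strictly, and at most at \<open>2 powr (j + 1)\<close>.\<close>
      define j where "j = \<lceil>log 2 l\<rceil> - 1"
      have j: "2 powr real_of_int j < l" "l \<le> 2 powr (real_of_int j + 1)"
        using \<open>l > 0\<close> by (simp_all add: j_def less_log_iff[symmetric] log_le_iff[symmetric]) linarith
      have "\<theta> < 1" using \<theta> p by (meson divide_less_eq_1_pos less_trans zero_less_one)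
      have "y \<in> B j" using B(2)[of j] j(2) False by (auto simp: l_def)
      have "k y \<le> C0 / l powr (1 - \<theta>)" using k[OF False] by (simp add: l_def)
      also have "\<dots> \<le> C0 / (2 powr real_of_int j) powr (1 - \<theta>)"
        using j(1) \<open>C0 \<ge> 0\<close> \<open>\<theta> < 1\<close> \<open>l > 0\<close>
        by (intro divide_left_mono powr_mono2 mult_pos_pos) auto
      also have "\<dots> = C0 * 2 powr (- real_of_int j * (1 - \<theta>))"
        by (simp add: powr_powr powr_minus divide_inverse)
      finally have "k y * h y \<le> C0 * 2 powr (- real_of_int j * (1 - \<theta>)) * h y"
        using h0 by (intro mult_right_mono)
      then have "ennreal (k y * h y) * indicator (- {x}) y
          \<le> ennreal (C0 * 2 powr (- real_of_int j * (1 - \<theta>))) * (ennreal (h y) * indicator (B j) y)"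
        using False \<open>y \<in> B j\<close> \<open>C0 \<ge> 0\<close> h0 by (simp flip: ennreal_mult add: ennreal_leI)
      \<comment> \<open>The sets \<open>B j\<close> may overlap, but only a lower bound of the sum
        is wanted and one term gives it.\<close>
      also have "\<dots> \<le> (\<integral>\<^sup>+j. ennreal (C0 * 2 powr (- real_of_int j * (1 - \<theta>))) * (ennreal (h y) * indicator (B j) y)
            \<partial>count_space UNIV)"
        by (rule nn_integral_ge_point) simp
      finally show ?thesis .
    qed simp
  qed
  also have "\<dots> = (\<integral>\<^sup>+j. ennreal (C0 * 2 powr (- real_of_int j * (1 - \<theta>))) * emeasure \<nu> (B j) \<partial>count_space UNIV)"
    by (subst nn_integral_swap_int) (simp_all add: nn_integral_cmult \<nu>_def emeasure_density)
  also have "\<dots> \<le> (\<integral>\<^sup>+j. ennreal (C0 * D * g) * (ennreal (2 powr (real_of_int j * \<theta>)) * indicator {j. real_of_int j \<le> L} j)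
       + ennreal (C0 * D * A) * (ennreal (2 powr (- real_of_int j * \<delta>)) * indicator {j. L \<le> real_of_int j} j) \<partial>count_space UNIV)"
  proof (rule nn_integral_mono)
    fix j :: int
    let ?c = "C0 * 2 powr (- real_of_int j * (1 - \<theta>))"
    have 1: "ennreal ?c * emeasure \<nu> (B j) \<le> ennreal (C0 * D * g) * ennreal (2 powr (real_of_int j * \<theta>))"
    proof -
      have "ennreal ?c * emeasure \<nu> (B j) \<le> ennreal ?c * ennreal (D * 2 powr real_of_int j * g)"
        using \<nu>B1 by (intro mult_left_mono) auto
      also have "\<dots> = ennreal (?c * (D * 2 powr real_of_int j * g))"
        using \<open>C0 \<ge> 0\<close> \<open>D > 0\<close> \<open>g > 0\<close> by (simp flip: ennreal_mult)
      also have "?c * (D * 2 powr real_of_int j * g) = C0 * D * g * (2 powr (- real_of_int j * (1 - \<theta>)) * 2 powr real_of_int j)"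
        by simp
      also have "2 powr (- real_of_int j * (1 - \<theta>)) * 2 powr real_of_int j = 2 powr (real_of_int j * \<theta>)"
        by (simp add: powr_add[symmetric] algebra_simps)
      finally show ?thesis using \<open>C0 \<ge> 0\<close> \<open>D > 0\<close> \<open>g > 0\<close> by (simp flip: ennreal_mult)
    qed
    have 2: "ennreal ?c * emeasure \<nu> (B j) \<le> ennreal (C0 * D * A) * ennreal (2 powr (- real_of_int j * \<delta>))"
    proof -
      have "ennreal ?c * emeasure \<nu> (B j) \<le> ennreal ?c * ennreal (D * 2 powr (real_of_int j * (1 - 1 / p)) * A)"
        using \<nu>B2 by (intro mult_left_mono) auto
      also have "\<dots> = ennreal (?c * (D * 2 powr (real_of_int j * (1 - 1 / p)) * A))"
        using \<open>C0 \<ge> 0\<close> \<open>D > 0\<close> \<open>A > 0\<close> by (simp flip: ennreal_mult)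
      also have "?c * (D * 2 powr (real_of_int j * (1 - 1 / p)) * A)
          = C0 * D * A * (2 powr (- real_of_int j * (1 - \<theta>)) * 2 powr (real_of_int j * (1 - 1 / p)))"
        by simp
      also have "2 powr (- real_of_int j * (1 - \<theta>)) * 2 powr (real_of_int j * (1 - 1 / p)) = 2 powr (- real_of_int j * \<delta>)"
        by (simp add: powr_add[symmetric] algebra_simps \<delta>_def)
      finally show ?thesis using \<open>C0 \<ge> 0\<close> \<open>D > 0\<close> \<open>A > 0\<close> by (simp flip: ennreal_mult)
    qed
    show "ennreal ?c * emeasure \<nu> (B j) \<le> ennreal (C0 * D * g) * (ennreal (2 powr (real_of_int j * \<theta>)) * indicator {j. real_of_int j \<le> L} j)
       + ennreal (C0 * D * A) * (ennreal (2 powr (- real_of_int j * \<delta>)) * indicator {j. L \<le> real_of_int j} j)"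
    proof (cases "real_of_int j \<le> L")
      case True
      then show ?thesis using order_trans[OF 1 add_increasing2[OF zero_le order_refl]] by simp
    next
      case False
      then show ?thesis using 2 by simp
    qed
  qed
  also have "\<dots> \<le> ennreal (C0 * D * g) * ennreal (2 powr (L * \<theta>) / (1 - 2 powr - \<theta>))
      + ennreal (C0 * D * A) * ennreal (2 powr (- L * \<delta>) / (1 - 2 powr - \<delta>))"
    using nn_integral_powr_atMost_int[OF \<theta>(1), of L] nn_integral_powr_atLeast_int[OF \<open>\<delta> > 0\<close>, of L]
    by (simp add: nn_integral_add nn_integral_cmult add_mono mult_left_mono)
  also have "\<dots> = ennreal (C0 * D * (g * 2 powr (L * \<theta>)) / (1 - 2 powr - \<theta>) + C0 * D * (A * 2 powr (- L * \<delta>)) / (1 - 2 powr - \<delta>))"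
  proof -
    have "2 powr - \<theta> < (1::real)" "2 powr - \<delta> < (1::real)"
      using \<theta> \<open>\<delta> > 0\<close> by (simp_all add: powr_less_one)
    then have "ennreal (C0 * D * g) * ennreal (2 powr (L * \<theta>) / (1 - 2 powr - \<theta>))
          = ennreal (C0 * D * g * (2 powr (L * \<theta>) / (1 - 2 powr - \<theta>)))"
        "ennreal (C0 * D * A) * ennreal (2 powr (- L * \<delta>) / (1 - 2 powr - \<delta>))
          = ennreal (C0 * D * A * (2 powr (- L * \<delta>) / (1 - 2 powr - \<delta>)))"
        "0 \<le> C0 * D * g * (2 powr (L * \<theta>) / (1 - 2 powr - \<theta>))"
        "0 \<le> C0 * D * A * (2 powr (- L * \<delta>) / (1 - 2 powr - \<delta>))"
      using \<open>C0 \<ge> 0\<close> \<open>D > 0\<close> \<open>A > 0\<close> \<open>g > 0\<close> by (simp_all flip: ennreal_mult)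
    then show ?thesis by (simp add: ennreal_plus[symmetric] mult.assoc del: ennreal_plus)
  qed
  \<comment> \<open>By the choice of \<open>L\<close>, \<open>2 powr L = (A / g) powr p\<close>,
    which turns both endpoint terms into the same product.\<close>
  also have "g * 2 powr (L * \<theta>) = A powr (p * \<theta>) * g powr (1 - p * \<theta>)"
  proof -
    have "2 powr (L * \<theta>) = (2 powr log 2 (A / g)) powr (p * \<theta>)"
      unfolding powr_powr by (simp add: L_def mult_ac)
    also have "\<dots> = A powr (p * \<theta>) / g powr (p * \<theta>)"
      using \<open>A > 0\<close> \<open>g > 0\<close> by (simp add: powr_divide)
    finally show ?thesis using \<open>g > 0\<close> by (simp add: powr_diff)
  qed
  also have "A * 2 powr (- L * \<delta>) = A powr (p * \<theta>) * g powr (1 - p * \<theta>)"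
  proof -
    have "p * \<delta> = 1 - p * \<theta>" using p by (simp add: \<delta>_def field_simps)
    have "2 powr (- L * \<delta>) = (2 powr log 2 (A / g)) powr (- (p * \<delta>))"
      unfolding powr_powr by (simp add: L_def mult_ac)
    also have "\<dots> = A powr (p * \<theta> - 1) / g powr (p * \<theta> - 1)"
      using \<open>A > 0\<close> \<open>g > 0\<close> \<open>p * \<delta> = 1 - p * \<theta>\<close> by (simp add: powr_divide)
    finally show ?thesis using \<open>g > 0\<close> \<open>A > 0\<close> by (simp add: powr_diff)
  qed
  also have "C0 * D * X / u + C0 * D * X / v = C0 * (D * (1 / u + 1 / v)) * X" for X u v :: real
    by (simp add: distrib_left distrib_right)
  finally show ?thesis
    unfolding hedberg_const_def D_def[symmetric] \<delta>_def[symmetric] .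
qed

subsection \<open>The fractional integral operator\<close>

text \<open>Regularity controls one variable at a time, so the pair is moved from
  \<open>(x, y)\<close> to \<open>(x', y)\<close> and then to \<open>(x', y')\<close>.\<close>

lemma regular_kernel_continuous:
  fixes K :: "'a \<Rightarrow> 'a \<Rightarrow> 'k::real_normed_vector"
  assumes "C \<ge> 0" and "C' > 0" and "\<epsilon> > 0" and "\<theta> \<le> 1"
    and reg: "\<And>x x' y. x \<noteq> y \<Longrightarrow> x' \<noteq> y \<Longrightarrow> C' * dist x x' \<le> dist x y \<Longrightarrow>
      norm (K x y - K x' y) + norm (K y x - K y x')
        \<le> C * dist x x' powr \<epsilon> / (dist x y powr \<epsilon> * lam x (dist x y) powr (1 - \<theta>))"
  shows "continuous_on {(x, y). x \<noteq> y} (\<lambda>(x, y). K x y)"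
  unfolding continuous_on_def
proof safe
  fix x y :: 'a assume "x \<noteq> y"
  define d where "d = dist x y"
  \<comment> \<open>Replacing the distance by its lower bound \<open>d / 2\<close> gives a constant
    depending on the base point alone, as \<open>lam\<close> is monotone in the radius.\<close>
  define Q where "Q z = C / ((d / 2) powr \<epsilon> * lam z (d / 2) powr (1 - \<theta>))" for z
  define F where "F = at (x, y) within {(x, y). x \<noteq> y}"
  have "d > 0" using \<open>x \<noteq> y\<close> by (simp add: d_def)
  have Q: "norm (K a b - K a' b) + norm (K b a - K b a') \<le> Q a * dist a a' powr \<epsilon>"
    if "a' \<noteq> b" "d / 2 \<le> dist a b" "C' * dist a a' \<le> d / 2" for a a' b
  proof -
    have "norm (K a b - K a' b) + norm (K b a - K b a')
        \<le> C * dist a a' powr \<epsilon> / (dist a b powr \<epsilon> * lam a (dist a b) powr (1 - \<theta>))"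
      using that \<open>d > 0\<close> by (intro reg) auto
    also have "C * dist a a' powr \<epsilon> / (dist a b powr \<epsilon> * lam a (dist a b) powr (1 - \<theta>))
      \<le> C * dist a a' powr \<epsilon> / ((d / 2) powr \<epsilon> * lam a (d / 2) powr (1 - \<theta>))"
    proof -
      have "(d / 2) powr \<epsilon> \<le> dist a b powr \<epsilon>"
        using that(2) \<open>d > 0\<close> \<open>\<epsilon> > 0\<close> by (intro powr_mono2) auto
      moreover have "lam a (d / 2) powr (1 - \<theta>) \<le> lam a (dist a b) powr (1 - \<theta>)"
        using that(2) \<open>d > 0\<close> \<open>\<theta> \<le> 1\<close> lam_pos[of "d / 2" a]
        by (intro powr_mono2 lam_mono) auto
      ultimately have "(d / 2) powr \<epsilon> * lam a (d / 2) powr (1 - \<theta>)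
          \<le> dist a b powr \<epsilon> * lam a (dist a b) powr (1 - \<theta>)"
        by (intro mult_mono) auto
      moreover have "0 < (d / 2) powr \<epsilon> * lam a (d / 2) powr (1 - \<theta>)"
        using \<open>d > 0\<close> lam_pos[of "d / 2" a] by simp
      ultimately show ?thesis using \<open>C \<ge> 0\<close> by (simp add: divide_left_mono)
    qed
    finally show ?thesis by (simp add: Q_def)
  qed
  have close: "eventually (\<lambda>w. norm ((case w of (x, y) \<Rightarrow> K x y) - K x y)
      \<le> Q x * dist x (fst w) powr \<epsilon> + Q y * dist y (snd w) powr \<epsilon>) F"
    unfolding F_def eventually_at
  \<comment> \<open>The bound \<open>d / 2\<close> keeps \<open>x'\<close> at distance at least
    \<open>d / 2\<close> from \<open>y\<close>; \<open>d / 2 / C'\<close> secures the proximity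
    condition of the regularity estimate.\<close>
  proof (intro exI[of _ "min (d / 2) (d / 2 / C')"] conjI ballI impI)
    fix w :: "'a \<times> 'a"
    assume w: "w \<in> {(x, y). x \<noteq> y}" "w \<noteq> (x, y) \<and> dist w (x, y) < min (d / 2) (d / 2 / C')"
    obtain x' y' where xy': "w = (x', y')" by (cases w)
    have x': "dist x x' < d / 2" "dist x x' < d / 2 / C'"
      using w(2) dist_fst_le[of w "(x, y)"] by (auto simp: xy' dist_commute)
    have y': "dist y y' < d / 2 / C'"
      using w(2) dist_snd_le[of w "(x, y)"] by (auto simp: xy' dist_commute)
    have far: "d / 2 \<le> dist y x'"
      using x'(1) dist_triangle[of x y x'] by (simp add: d_def dist_commute)
    then have "x' \<noteq> y" using \<open>d > 0\<close> by auto
    have "norm (K x' y' - K x y) \<le> norm (K x y - K x' y) + norm (K x' y - K x' y')"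
      using norm_triangle_ineq[of "K x' y' - K x' y" "K x' y - K x y"] by (simp add: norm_minus_commute)
    also have "norm (K x y - K x' y) + norm (K y x - K y x') \<le> Q x * dist x x' powr \<epsilon>"
      using x' \<open>d > 0\<close> \<open>C' > 0\<close> \<open>x' \<noteq> y\<close> by (intro Q) (auto simp: d_def field_simps)
    then have "norm (K x y - K x' y) \<le> Q x * dist x x' powr \<epsilon>"
      using norm_ge_zero[of "K y x - K y x'"] by linarith
    \<comment> \<open>The second move is based at the fixed point \<open>y\<close>, so its constant
      \<open>Q y\<close> does not vary with \<open>x'\<close>.\<close>
    moreover have "norm (K y x' - K y' x') + norm (K x' y - K x' y') \<le> Q y * dist y y' powr \<epsilon>"
      using y' w(1) far \<open>C' > 0\<close> by (intro Q) (auto simp: xy' field_simps)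
    then have "norm (K x' y - K x' y') \<le> Q y * dist y y' powr \<epsilon>"
      using norm_ge_zero[of "K y x' - K y' x'"] by linarith
    ultimately show "norm ((case w of (x, y) \<Rightarrow> K x y) - K x y)
      \<le> Q x * dist x (fst w) powr \<epsilon> + Q y * dist y (snd w) powr \<epsilon>"
      by (simp add: xy')
  qed (use \<open>d > 0\<close> \<open>C' > 0\<close> in auto)
  have w: "((\<lambda>w. w) \<longlongrightarrow> (x, y)) F" unfolding F_def by (rule tendsto_ident_at)
  have "((\<lambda>w. dist x (fst w)) \<longlongrightarrow> dist x x) F" "((\<lambda>w. dist y (snd w)) \<longlongrightarrow> dist y y) F"
    using tendsto_dist[OF tendsto_const tendsto_fst[OF w]] tendsto_dist[OF tendsto_const tendsto_snd[OF w]]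
    by (simp_all only: fst_conv snd_conv)
  then have "((\<lambda>w. dist x (fst w) powr \<epsilon>) \<longlongrightarrow> 0) F" "((\<lambda>w. dist y (snd w) powr \<epsilon>) \<longlongrightarrow> 0) F"
    using \<open>\<epsilon> > 0\<close> by (auto intro!: tendsto_zero_powrI)
  then have "((\<lambda>w. Q x * dist x (fst w) powr \<epsilon> + Q y * dist y (snd w) powr \<epsilon>) \<longlongrightarrow> 0) F"
    by (auto intro!: tendsto_add_zero tendsto_mult_right_zero)
  from Lim_null_comparison[OF close this]
  show "((\<lambda>(x, y). K x y) \<longlongrightarrow> K x y) (at (x, y) within {(x, y). x \<noteq> y})"
    unfolding F_def by (rule LIM_zero_cancel)
qed

text \<open>The complement of the diagonal is open, so the kernel extended by zero is Borel on the
  product space; separability puts those Borel sets into the product sigma-algebra.\<close>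

lemma continuous_off_diagonal_measurable:
  fixes K :: "'a \<Rightarrow> 'a \<Rightarrow> 'k::real_normed_vector"
  assumes "continuous_on {(x, y). x \<noteq> y} (\<lambda>(x, y). K x y)"
  shows "(\<lambda>(x, y). indicator (- {x}) y *\<^sub>R K x y) \<in> borel_measurable (M \<Otimes>\<^sub>M M)"
proof -
  let ?f = "\<lambda>w. indicator {(x, y). x \<noteq> y} w *\<^sub>R (case w of (x, y) \<Rightarrow> K x y)"
  obtain D :: "'a set" where "countable D" "\<forall>x. \<forall>e>0. \<exists>d\<in>D. dist d x < e" using separable by blast
  from countable_dense_sets_borel_prod[OF this] 
  have sub: "sets borel \<subseteq> sets (M \<Otimes>\<^sub>M M)"
    using sets_pair_measure_cong[OF sets_M sets_M] by simp
  have "open {w :: 'a \<times> 'a. fst w \<noteq> snd w}"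
    by (intro open_Collect_neq continuous_intros)
  moreover have "{w :: 'a \<times> 'a. fst w \<noteq> snd w} = {(x, y). x \<noteq> y}" by auto
  ultimately have "open {(x, y :: 'a). x \<noteq> y}" by simp
  then have "?f \<in> borel_measurable borel"
    using assms by (intro borel_measurable_continuous_on_indicator) auto
  then have "?f -` S \<in> sets (M \<Otimes>\<^sub>M M)" if "S \<in> sets borel" for S
    using measurable_sets[of ?f borel borel S] that sub by auto
  then have "?f \<in> borel_measurable (M \<Otimes>\<^sub>M M)"
    by (auto simp: measurable_def space_pair_measure)
  moreover have "?f = (\<lambda>(x, y). indicator (- {x}) y *\<^sub>R K x y)"
    by (auto simp: indicator_def)
  ultimately show ?thesis by simp
qed

text \<open>In the \<open>q\<close>-th power of the Hedberg inequality,
  \<open>(1 - p * \<theta>) * q = p\<close> leaves \<open>g x powr p\<close>, whose integral is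
  bounded by the strong type estimate. Integrability belongs to the conclusion because the Bochner
  integral would otherwise default to 0.\<close>

lemma fractional_integral_Lp_Lq:
  fixes K :: "'a \<Rightarrow> 'a \<Rightarrow> 'k::{real_normed_field, banach, second_countable_topology}"
  assumes K_meas: "(\<lambda>(x, y). indicator (- {x}) y *\<^sub>R K x y) \<in> borel_measurable (M \<Otimes>\<^sub>M M)"
    and K_size: "\<And>x y. x \<noteq> y \<Longrightarrow> norm (K x y) \<le> C0 / lam x (dist x y) powr (1 - \<theta>)"
    and C0: "C0 \<ge> 0" and p: "p > 1" and \<theta>: "0 < \<theta>" "\<theta> < 1 / p" and q: "1 / q = 1 / p - \<theta>"
  shows "\<exists>C>0. \<forall>f\<in>Lp_space p M.
           (AE x in M. set_integrable M (- {x}) (\<lambda>y. K x y * f y)) \<and>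
           fractional_integral M K f \<in> Lp_space q M \<and>
           Lp_norm q M (fractional_integral M K f) \<le> C * Lp_norm p M f"
proof -
  have "1 / q > 0" using q \<theta> by simp
  then have "q > 0" by (simp add: zero_less_divide_iff)
  have exps: "p * \<theta> = 1 - p / q" using q p by (simp add: field_simps)
  define c1 where "c1 = C0 * hedberg_const p \<theta>"
  define c2 where "c2 = Cd\<^sup>2 * 2 powr (2 * p) / (1 - 2 powr - (p - 1))"
  have "2 powr - \<theta> < (1::real)" "2 powr - (1 / p - \<theta>) < (1::real)" "2 powr - (p - 1) < (1::real)"
    using \<theta> p by (auto intro!: powr_less_one)
  then have "c1 \<ge> 0" "c2 \<ge> 0"
    using C0 by (auto simp: c1_def c2_def hedberg_const_def intro!: mult_nonneg_nonneg add_nonneg_nonneg)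
  \<comment> \<open>The added 1 keeps \<open>C\<close> positive even when \<open>c1\<close> or
    \<open>c2\<close> vanishes.\<close>
  define C where "C = (c1 powr q * c2) powr (1 / q) + 1"
  have "C > 0" by (simp add: C_def add_nonneg_pos)
  show ?thesis
  proof (intro exI[of _ C] conjI ballI \<open>C > 0\<close>)
    fix f :: "'a \<Rightarrow> 'k" assume "f \<in> Lp_space p M"
    then have f[measurable]: "f \<in> borel_measurable M" and fp: "integrable M (\<lambda>x. norm (f x) powr p)"
      by (auto simp: Lp_space_def)
    define If where "If = fractional_integral M K f"
    define A where "A = Lp_norm p M f"
    have "A \<ge> 0" by (simp add: A_def Lp_norm_def)
    have A_p: "A powr p = (\<integral>x. norm (f x) powr p \<partial>M)"
      using p by (simp add: A_def Lp_norm_def powr_powr)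
    then have nn_A: "(\<integral>\<^sup>+x. ennreal (norm (f x) powr p) \<partial>M) = ennreal (A powr p)"
      using nn_integral_eq_integral[OF fp] by simp
    have Kf[measurable]: "(\<lambda>(x, y). (indicator (- {x}) y *\<^sub>R K x y) * f y) \<in> borel_measurable (M \<Otimes>\<^sub>M M)"
      using borel_measurable_times[OF K_meas measurable_compose[OF measurable_snd f]]
      by (simp add: case_prod_beta)
    have Kf_x[measurable]: "(\<lambda>y. (indicator (- {x}) y *\<^sub>R K x y) * f y) \<in> borel_measurable M" for x
      using measurable_Pair2[OF Kf, of x] by simp
    have If_eq: "If x = (\<integral>y. (indicator (- {x}) y *\<^sub>R K x y) * f y \<partial>M)" for x
      by (simp add: If_def fractional_integral_def set_lebesgue_integral_def)
    have si_eq: "set_integrable M (- {x}) (\<lambda>y. K x y * f y)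
        \<longleftrightarrow> integrable M (\<lambda>y. (indicator (- {x}) y *\<^sub>R K x y) * f y)" for x
      by (simp add: set_integrable_def)
    interpret sigma_finite_measure M by (rule sigma_finite_M)
    have [measurable]: "If \<in> borel_measurable M"
      unfolding If_eq[abs_def] by (rule borel_measurable_lebesgue_integral[OF Kf])
    have "(AE x in M. set_integrable M (- {x}) (\<lambda>y. K x y * f y)) \<and>
      (\<integral>\<^sup>+x. ennreal (norm (If x) powr q) \<partial>M) \<le> ennreal (c1 powr q * c2 * A powr q)"
    \<comment> \<open>\<open>Hedberg_inequality\<close> asks for a positive norm bound. If
      \<open>A = 0\<close>, then \<open>f\<close> vanishes almost everywhere and \<open>If\<close>
      vanishes everywhere.\<close>
    proof (cases "A = 0")
      case True
      then have "AE x in M. ennreal (norm (f x) powr p) = 0"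
        using nn_A p by (subst nn_integral_0_iff_AE[symmetric]) auto
      then have ae: "AE y in M. (indicator (- {x}) y *\<^sub>R K x y) * f y = 0" for x
        by eventually_elim simp
      have "integrable M (\<lambda>y. (indicator (- {x}) y *\<^sub>R K x y) * f y)" for x
      proof (rule integrable_cong_AE_imp)
        show "AE y in M. 0 = (indicator (- {x}) y *\<^sub>R K x y) * f y"
          using ae[of x] by eventually_elim (rule sym)
      qed (rule integrable_zero, rule Kf_x)
      moreover have "If x = 0" for x
        unfolding If_eq using ae by (rule integral_eq_zero_AE)
      ultimately show ?thesis using \<open>q > 0\<close> by (simp add: si_eq)
    next
      case False
      with \<open>A \<ge> 0\<close> have "A > 0" by simp
      define \<nu> where "\<nu> = density M (\<lambda>x. ennreal (norm (f x)))"
      have "(\<integral>\<^sup>+x. ennreal (norm (f x) powr p) \<partial>M) < \<infinity>" by (simp add: nn_A)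
      from maximal_strong_type[OF _ _ p this] obtain g where
        g[measurable]: "g \<in> borel_measurable M" and g0: "\<And>x. 0 \<le> g x" and
        g_max: "AE x in M. \<forall>z r. r > 0 \<longrightarrow> x \<in> ball z r \<longrightarrow> emeasure \<nu> (ball z r) \<le> ennreal (lam z r * g x)" and
        g_p: "(\<integral>\<^sup>+x. ennreal (g x powr p) \<partial>M) \<le> ennreal c2 * ennreal (A powr p)"
        unfolding \<nu>_def c2_def nn_A by auto
      have key: "integrable M (\<lambda>y. (indicator (- {x}) y *\<^sub>R K x y) * f y) \<and>
          norm (If x) \<le> c1 * (A powr (p * \<theta>) * g x powr (1 - p * \<theta>))"
        if x: "\<forall>z r. r > 0 \<longrightarrow> x \<in> ball z r \<longrightarrow> emeasure \<nu> (ball z r) \<le> ennreal (lam z r * g x)" for x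
      proof -
        have x_ball: "emeasure \<nu> (ball x r) \<le> ennreal (lam x r * g x)" if "r > 0" for r
          using x that by simp
        \<comment> \<open>If \<open>g x\<close> were 0, all balls about \<open>x\<close>, hence the
          whole space, would be null for \<open>\<nu>\<close>; then \<open>f\<close> would vanish
          almost everywhere, against \<open>A > 0\<close>.\<close>
        have "g x \<noteq> 0"
        proof
          assume "g x = 0"
          then have "emeasure \<nu> (ball x (real (Suc m))) = 0" for m
            using x_ball[of "real (Suc m)"] by simp
          then have "emeasure \<nu> (\<Union>m. ball x (real (Suc m))) = 0"
            by (intro emeasure_UN_eq_0) (auto simp: \<nu>_def sets_M)
          then have "(\<integral>\<^sup>+x. ennreal (norm (f x)) \<partial>M) = 0"
            unfolding UN_balls using sets.top[of M] by (simp add: \<nu>_def emeasure_density)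
          then have "AE x in M. ennreal (norm (f x)) = 0"
            by (subst (asm) nn_integral_0_iff_AE) auto
          then have "AE x in M. ennreal (norm (f x) powr p) = 0"
            by eventually_elim simp
          then have "ennreal (A powr p) = 0"
            unfolding nn_A[symmetric] by (subst nn_integral_0_iff_AE) auto
          with \<open>A > 0\<close> show False by simp
        qed
        with g0[of x] have "g x > 0" by simp
        have "(\<integral>\<^sup>+y. ennreal (norm ((indicator (- {x}) y *\<^sub>R K x y) * f y)) \<partial>M)
            = (\<integral>\<^sup>+y. ennreal (norm (K x y) * norm (f y)) * indicator (- {x}) y \<partial>M)"
          by (intro nn_integral_cong) (auto simp: indicator_def norm_mult)
        also have "\<dots> \<le> ennreal (c1 * (A powr (p * \<theta>) * g x powr (1 - p * \<theta>)))"
          unfolding c1_def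
          using K_size C0 p \<theta> \<open>A > 0\<close> \<open>g x > 0\<close> nn_A x_ball
          by (intro Hedberg_inequality) (auto simp: \<nu>_def)
        finally have J: "(\<integral>\<^sup>+y. ennreal (norm ((indicator (- {x}) y *\<^sub>R K x y) * f y)) \<partial>M)
            \<le> ennreal (c1 * (A powr (p * \<theta>) * g x powr (1 - p * \<theta>)))" .
        have int: "integrable M (\<lambda>y. (indicator (- {x}) y *\<^sub>R K x y) * f y)"
          by (rule integrableI_bounded[OF Kf_x]) (rule le_less_trans[OF J], simp)
        have "ennreal (norm (If x)) \<le> ennreal (c1 * (A powr (p * \<theta>) * g x powr (1 - p * \<theta>)))"
          unfolding If_eq using integral_norm_bound_ennreal[OF int] J by (rule order_trans)
        with int \<open>c1 \<ge> 0\<close> show ?thesis by (simp add: ennreal_le_iff)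
      qed
      have "AE x in M. ennreal (norm (If x) powr q) \<le> ennreal (c1 powr q * A powr (q - p)) * ennreal (g x powr p)"
        using g_max
      proof eventually_elim
        case (elim x)
        then have "norm (If x) powr q \<le> (c1 * (A powr (p * \<theta>) * g x powr (1 - p * \<theta>))) powr q"
          using key \<open>q > 0\<close> by (intro powr_mono2) auto
        also have "\<dots> = c1 powr q * A powr (p * \<theta> * q) * g x powr ((1 - p * \<theta>) * q)"
          using \<open>c1 \<ge> 0\<close> \<open>A > 0\<close> g0[of x] by (simp add: powr_mult powr_powr)
        also have "p * \<theta> * q = q - p" unfolding exps using \<open>q > 0\<close> by (simp add: left_diff_distrib)
        also have "(1 - p * \<theta>) * q = p" using \<open>q > 0\<close> by (simp add: exps)
        finally show ?case by (simp flip: ennreal_mult add: ennreal_leI)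
      qed
      then have "(\<integral>\<^sup>+x. ennreal (norm (If x) powr q) \<partial>M)
          \<le> (\<integral>\<^sup>+x. ennreal (c1 powr q * A powr (q - p)) * ennreal (g x powr p) \<partial>M)"
        by (rule nn_integral_mono_AE)
      also have "\<dots> = ennreal (c1 powr q * A powr (q - p)) * (\<integral>\<^sup>+x. ennreal (g x powr p) \<partial>M)"
        by (rule nn_integral_cmult) measurable
      also have "\<dots> \<le> ennreal (c1 powr q * A powr (q - p)) * (ennreal c2 * ennreal (A powr p))"
        using g_p by (intro mult_left_mono) auto
      also have "\<dots> = ennreal (c1 powr q * A powr (q - p) * (c2 * A powr p))"
        using \<open>c2 \<ge> 0\<close> by (simp flip: ennreal_mult)
      also have "c1 powr q * A powr (q - p) * (c2 * A powr p) = c1 powr q * c2 * (A powr (q - p) * A powr p)"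
        by simp
      also have "A powr (q - p) * A powr p = A powr q" by (simp add: powr_add[symmetric])
      finally show ?thesis using g_max key unfolding si_eq by (auto elim: eventually_mono)
    qed
    then have si: "AE x in M. set_integrable M (- {x}) (\<lambda>y. K x y * f y)"
      and If_q: "(\<integral>\<^sup>+x. ennreal (norm (If x) powr q) \<partial>M) \<le> ennreal (c1 powr q * c2 * A powr q)" by auto
    from si show "AE x in M. set_integrable M (- {x}) (\<lambda>y. K x y * f y)" .
    have int: "integrable M (\<lambda>x. norm (If x) powr q)"
      using If_q by (intro integrableI_bounded) (auto intro: le_less_trans)
    then show "fractional_integral M K f \<in> Lp_space q M"
      unfolding If_def[symmetric] by (simp add: Lp_space_def)
    have "(\<integral>x. norm (If x) powr q \<partial>M) \<le> c1 powr q * c2 * A powr q"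
      using If_q \<open>c2 \<ge> 0\<close> by (subst (asm) nn_integral_eq_integral[OF int]) (auto simp: ennreal_le_iff)
    then have "Lp_norm q M If \<le> (c1 powr q * c2 * A powr q) powr (1 / q)"
      unfolding Lp_norm_def using \<open>q > 0\<close> by (intro powr_mono2) auto
    also have "\<dots> = (c1 powr q * c2) powr (1 / q) * A"
      using \<open>c2 \<ge> 0\<close> \<open>A \<ge> 0\<close> \<open>q > 0\<close> by (simp add: powr_mult powr_powr)
    also have "\<dots> \<le> C * A" using \<open>A \<ge> 0\<close> by (intro mult_right_mono) (auto simp: C_def)
    finally show "Lp_norm q M (fractional_integral M K f) \<le> C * Lp_norm p M f"
      by (simp add: If_def A_def)
  qed
qed

end

section \<open>From the hypotheses on space and kernel to the abstract estimate\<close>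

theorem theorem1p1:
  fixes M :: "'a::metric_space measure"
    and lam :: "'a \<Rightarrow> real \<Rightarrow> real"
    and N0 :: nat
    and n \<alpha> \<epsilon> p q :: real
    and K :: "'a \<Rightarrow> 'a \<Rightarrow> 'k::{real_normed_field, banach, second_countable_topology}"
  assumes "nonhomogeneous_space M lam N0"
    and "n = log 2 (real N0)"
    and "0 < \<alpha>" and "\<alpha> < n"
    and "1 < p" and "p < n / \<alpha>"
    and "1 / q = 1 / p - \<alpha> / n"
    and "0 < \<epsilon>" and "\<epsilon> \<le> 1"
    and "fractional_kernel M lam n \<alpha> \<epsilon> K"
  shows "\<exists>C>0. \<forall>f \<in> Lp_space p M.
           (AE x in M. set_integrable M (- {x}) (\<lambda>y. K x y * f y)) \<and>
           fractional_integral M K f \<in> Lp_space q M \<and>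
           Lp_norm q M (fractional_integral M K f) \<le> C * Lp_norm p M f"
proof -
  have doubling: "geometrically_doubling (UNIV :: 'a set) N0" and upper: "upper_doubling M lam"
    using assms(1) by (auto simp: nonhomogeneous_space_def)
  obtain Cd where Cd: "\<And>x r. r > 0 \<Longrightarrow> emeasure M (ball x r) \<le> ennreal (lam x r) \<and> lam x r \<le> Cd * lam x (r / 2)"
    using upper unfolding upper_doubling_def by blast
  interpret upper_doubling_measure M lam Cd
  proof
    show "lam x r \<le> lam x s" if "0 < r" "r \<le> s" for x r s
      using upper that by (auto simp: upper_doubling_def mono_on_def)
    show "lam x (2 * r) \<le> Cd * lam x r" if "r > 0" for x r
      using Cd[of "2 * r" x] that by simp
    show "sets M = sets borel" and "\<And>x r. r > 0 \<Longrightarrow> lam x r > 0"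
      using upper by (auto simp: upper_doubling_def)
    show "emeasure M (ball x r) \<le> ennreal (lam x r)" if "r > 0" for x r using Cd[OF that] by blast
  qed (rule geometrically_doubling_countable_dense[OF doubling])
  obtain C C' where C: "C > 0" "C' > 0"
    and K_size: "\<And>x y. x \<noteq> y \<Longrightarrow> norm (K x y) \<le> C / lam x (dist x y) powr (1 - \<alpha> / n)"
    and K_reg: "\<And>x x' y. x \<noteq> y \<Longrightarrow> x' \<noteq> y \<Longrightarrow> C' * dist x x' \<le> dist x y \<Longrightarrow>
      norm (K x y - K x' y) + norm (K y x - K y x')
        \<le> C * dist x x' powr \<epsilon> / (dist x y powr \<epsilon> * lam x (dist x y) powr (1 - \<alpha> / n))"
  proof -
    from assms(10) obtain C C' where "C > 0 \<and> C' > 0 \<and>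
        (\<forall>x y. x \<noteq> y \<longrightarrow> norm (K x y) \<le> C / (lam x (dist x y)) powr (1 - \<alpha> / n)) \<and>
        (\<forall>x x' y. x \<noteq> y \<and> x' \<noteq> y \<and> C' * dist x x' \<le> dist x y \<longrightarrow>
           norm (K x y - K x' y) + norm (K y x - K y x')
             \<le> C * dist x x' powr \<epsilon>
                 / (dist x y powr \<epsilon> * (lam x (dist x y)) powr (1 - \<alpha> / n)))"
      unfolding fractional_kernel_def by metis
    then show thesis by (intro that[of C C']) simp_all
  qed
  \<comment> \<open>\<open>p < n / \<alpha>\<close> becomes \<open>\<alpha> / n < 1 / p\<close>,
    which makes the geometric series above the balancing scale converge; with \<open>1 < p\<close>
    it also gives \<open>\<alpha> / n \<le> 1\<close>.\<close>
  have \<theta>: "0 < \<alpha> / n" "\<alpha> / n < 1 / p" "\<alpha> / n \<le> 1" using assms(3-6) by (auto simp: field_simps)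
  have "continuous_on {(x, y). x \<noteq> y} (\<lambda>(x, y). K x y)"
    using C \<theta>(3) assms(8) K_reg by (intro regular_kernel_continuous[of C C' \<epsilon> "\<alpha> / n"]) auto
  from fractional_integral_Lp_Lq[OF continuous_off_diagonal_measurable[OF this] K_size less_imp_le[OF C(1)] assms(5) \<theta>(1,2) assms(7)]
  show ?thesis .
qed

end
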